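(* Let $n\ge 1$, $1<p<\infty$, $z_0=(z_0^{(1)},\ldots,z_0^{(n)})\in\mathbb{D}^n$ and $w_0\in\mathbb{C}$. Among all $f\in H^p(\mathbb{D}^n)$ satisfying the single interpolation condition $f(z_0)=w_0$ there is a unique one of minimal $H^p(\mathbb{D}^n)$-norm, and it is given by $$f_{\min}(z)=w_0\left(\prod_{j=1}^n\frac{1-|z_0^{(j)}|^2}{1-z_j\overline{z_0^{(j)}}}\right)^{\frac2p},\qquad z=(z_1,\ldots,z_n)\in\mathbb{D}^n.$$ In addition, $\|f_{\min}\|_{H^p(\mathbb{D}^n)}=|w_0|\prod_{j=1}^n(1-|z_0^{(j)}|^2)^{\frac1p}$.
   Context: $\mathbb{D}=\{z\in\mathbb{C}:|z|<1\}$. The Hardy space $H^p(\mathbb{D}^n)$ on the polydisk is the space of holomorphic functions $f:\mathbb{D}^n\to\mathbb{C}$ with $$\|f\|_{H^p(\mathbb{D}^n)}=\sup_{0<r<1}\left(\frac1{(2\pi)^n}\int_0^{2\pi}\cdots\int_0^{2\pi}|f(re^{it_1},\ldots,re^{it_n})|^p\,dt_1\cdots dt_n\right)^{1/p}<\infty .$$ The power $(\prod_j\cdot)^{2/p}$ denotes the holomorphic branch on $\mathbb{D}^n$ that takes the value $1$ at $z=z_0$, i.e. the product of the principal branches of the $\frac2p$-th powers of the individual factors (each factor has positive real part). *)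

theory Defs
  imports "HOL-Complex_Analysis.Complex_Analysis"
begin

text \<open>Points of \<open>n\<close>-dimensional complex space are vectors \<open>complex ^ 'n\<close>, with \<open>n = CARD('n) \<ge> 1\<close>.\<close>

definition polydisk :: "(complex ^ 'n) set" where
  "polydisk = {z. \<forall>j. norm (z $ j) < 1}"

text \<open>
  Holomorphy in several variables, on an open set: the real Frechet derivative exists at every
  point and is complex linear. Additivity is already part of \<^const>\<open>has_derivative\<close>, so only
  complex homogeneity is required. The library's \<^const>\<open>holomorphic_on\<close> covers one variable only.
\<close>

definition holomorphic_vec_on :: "(complex ^ 'n \<Rightarrow> complex) \<Rightarrow> (complex ^ 'n) set \<Rightarrow> bool"
    (infixl "holomorphic'_vec'_on" 50) where
  "f holomorphic_vec_on S \<longleftrightarrow>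
     (\<forall>z\<in>S. \<exists>L. (f has_derivative L) (at z) \<and> (\<forall>c v. L (c *s v) = c * L v))"

definition hardy_mean :: "real \<Rightarrow> (complex ^ 'n \<Rightarrow> complex) \<Rightarrow> real \<Rightarrow> real" where
  "hardy_mean p f r =
     (1 / (2 * pi) ^ CARD('n) *
       (LINT t : cbox (0 :: real ^ 'n) (\<chi> j. 2 * pi) | lborel.
          norm (f (\<chi> j. of_real r * cis (t $ j))) powr p)) powr (1 / p)"

text \<open>
  For holomorphic \<open>f\<close> the integrand above is continuous, so each mean is finite and
  the norm is finite exactly if the means are bounded above. Outside
  \<open>hardy_space p\<close> the real-valued supremum \<open>hardy_norm p f\<close> carries no meaning.
\<close>

definition hardy_norm :: "real \<Rightarrow> (complex ^ 'n \<Rightarrow> complex) \<Rightarrow> real" where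
  "hardy_norm p f = (SUP r\<in>{0<..<1}. hardy_mean p f r)"

text \<open>
  Elements are total functions whose values outside the polydisk are irrelevant; two of them
  represent the same Hardy space function if they agree on \<^const>\<open>polydisk\<close>.
\<close>

definition hardy_space :: "real \<Rightarrow> (complex ^ 'n \<Rightarrow> complex) set" where
  "hardy_space p =
     {f. f holomorphic_vec_on polydisk \<and> bdd_above (hardy_mean p f ` {0<..<1})}"

text \<open>
  Complex \<^const>\<open>powr\<close> is the principal branch. On the polydisk every factor has positive real part.
\<close>

definition f_min :: "real \<Rightarrow> complex ^ 'n \<Rightarrow> complex \<Rightarrow> complex ^ 'n \<Rightarrow> complex" where
  "f_min p z0 w0 z =
     w0 * (\<Prod>j\<in>UNIV. (of_real (1 - (norm (z0 $ j))\<^sup>2) / (1 - z $ j * cnj (z0 $ j)))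
                        powr of_real (2 / p))"

end

theory Submission
  imports Defs
begin

text \<open>
  On the torus of radius \<open>r\<close> close to 1, \<open>|f_min|\<^sup>p\<close> is, up to a constant factor and an error that
  vanishes as \<open>r\<close> tends to 1, the Poisson kernel of \<open>z\<^sub>0\<close>. For a competitor \<open>f\<close> and \<open>w\<^sub>0 \<noteq> 0\<close>, the
  quotient \<open>u = f / f_min\<close> is holomorphic, its Poisson average at \<open>z\<^sub>0\<close> is \<open>u z\<^sub>0 = 1\<close>, and the Poisson
  average of \<open>|u|\<^sup>p\<close> is asymptotically at most \<open>(\<parallel>f\<parallel> / \<parallel>f_min\<parallel>)\<^sup>p\<close>. Jensen's inequality gives
  minimality. If \<open>f\<close> is also minimal, then the average of the strictly positive defect
  \<open>|u|\<^sup>p - 1 - p Re (u - 1)\<close> tends to 0, hence so does the average of \<open>|u - 1|\<close>. Since Poisson kernels of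
  different points are comparable, this forces \<open>u = 1\<close>. No boundary values are needed.
\<close>

subsection \<open>Holomorphic functions of several variables\<close>

lemma open_polydisk: "open (polydisk :: (complex ^ 'n) set)"
proof -
  have eq: "polydisk = (\<Inter>j. {z :: complex ^ 'n. norm (z $ j) < 1})"
    by (auto simp: polydisk_def)
  show ?thesis
    unfolding eq by (intro open_INT ballI open_Collect_less continuous_intros) auto
qed

lemma holomorphic_vec_on_imp_continuous_on:
  assumes "f holomorphic_vec_on S"
  shows "continuous_on S f"
proof -
  have "isCont f z" if "z \<in> S" for z
    using assms that has_derivative_continuous unfolding holomorphic_vec_on_def by blast
  then show ?thesis by (simp add: continuous_at_imp_continuous_on)
qed

lemma holomorphic_vec_on_const: "(\<lambda>z. c) holomorphic_vec_on S"
  unfolding holomorphic_vec_on_def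
  by (auto intro!: exI[of _ "\<lambda>v. 0"])

lemma holomorphic_vec_on_component: "(\<lambda>z. z $ j) holomorphic_vec_on S"
  unfolding holomorphic_vec_on_def
  by (auto intro!: exI[of _ "\<lambda>v. v $ j"] bounded_linear_imp_has_derivative bounded_linear_vec_nth)

lemma holomorphic_vec_on_mult:
  assumes "f holomorphic_vec_on S" "g holomorphic_vec_on S"
  shows "(\<lambda>z. f z * g z) holomorphic_vec_on S"
  unfolding holomorphic_vec_on_def
proof
  fix z assume "z \<in> S"
  then obtain L M where L: "(f has_derivative L) (at z)" "\<And>c v. L (c *s v) = c * L v"
    and M: "(g has_derivative M) (at z)" "\<And>c v. M (c *s v) = c * M v"
    using assms unfolding holomorphic_vec_on_def by meson
  have "((\<lambda>z. f z * g z) has_derivative (\<lambda>v. f z * M v + L v * g z)) (at z)"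
    using has_derivative_mult[OF L(1) M(1)] by simp
  then show "\<exists>L. ((\<lambda>z. f z * g z) has_derivative L) (at z) \<and> (\<forall>c v. L (c *s v) = c * L v)"
    using L(2) M(2) by (auto simp: algebra_simps intro!: exI)
qed

lemma holomorphic_vec_on_prod:
  assumes "finite I" "\<And>i. i \<in> I \<Longrightarrow> f i holomorphic_vec_on S"
  shows "(\<lambda>z. \<Prod>i\<in>I. f i z) holomorphic_vec_on S"
  using assms
  by (induction I rule: finite_induct)
     (auto intro!: holomorphic_vec_on_const holomorphic_vec_on_mult)

lemma holomorphic_vec_on_compose:
  assumes "f holomorphic_vec_on S" "\<And>z. z \<in> S \<Longrightarrow> h field_differentiable at (f z)"
  shows "(\<lambda>z. h (f z)) holomorphic_vec_on S"
  unfolding holomorphic_vec_on_def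
proof
  fix z assume z: "z \<in> S"
  then obtain L where L: "(f has_derivative L) (at z)" "\<And>c v. L (c *s v) = c * L v"
    using assms(1) unfolding holomorphic_vec_on_def by meson
  obtain D where D: "(h has_field_derivative D) (at (f z))"
    using assms(2)[OF z] by (auto simp: field_differentiable_def)
  have "((\<lambda>z. h (f z)) has_derivative (\<lambda>v. D * L v)) (at z)"
    using has_derivative_compose[OF L(1) D[unfolded has_field_derivative_def]] .
  then show "\<exists>L. ((\<lambda>z. h (f z)) has_derivative L) (at z) \<and> (\<forall>c v. L (c *s v) = c * L v)"
    using L(2) by (auto simp: algebra_simps intro!: exI)
qed

text \<open>This gives access to one-variable Cauchy theory. The slice map is affine with derivative
  \<open>c *s axis k 1\<close>, and complex homogeneity of \<open>L\<close> turns the chain rule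
  into multiplication by the single number \<open>L (axis k 1)\<close>. The entry
  \<open>z $ k\<close> is overwritten, so only the other coordinates are constrained.\<close>

lemma holomorphic_vec_on_slice:
  fixes f :: "complex ^ 'n \<Rightarrow> complex" and z :: "complex ^ 'n"
  assumes f: "f holomorphic_vec_on polydisk" and z: "\<And>j. j \<noteq> k \<Longrightarrow> norm (z $ j) < 1"
  shows "(\<lambda>w. f (\<chi> j. if j = k then w else z $ j)) holomorphic_on ball 0 1"
proof -
  let ?s = "\<lambda>w. \<chi> j. if j = k then w else z $ j"
  have "\<exists>D. ((\<lambda>w. f (?s w)) has_field_derivative D) (at w)" if w: "w \<in> ball 0 1" for w
  proof -
    have "?s w \<in> polydisk"
      using w z by (auto simp: polydisk_def)
    then obtain L where L: "(f has_derivative L) (at (?s w))" "\<And>c v. L (c *s v) = c * L v"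
      using f unfolding holomorphic_vec_on_def by meson
    have s: "(?s has_derivative (\<lambda>c. c *s axis k 1)) (at w)"
    proof -
      have "bounded_linear (\<lambda>c :: complex. c *s axis k (1 :: complex) :: complex ^ 'n)"
        by (intro linear_conv_bounded_linear[THEN iffD1] linearI)
           (auto simp: vec_eq_iff algebra_simps)
      then have "((\<lambda>c. ?s 0 + c *s axis k 1) has_derivative (\<lambda>c. 0 + c *s axis k 1)) (at w)"
        by (intro has_derivative_add has_derivative_const bounded_linear_imp_has_derivative)
      moreover have "?s = (\<lambda>c. ?s 0 + c *s axis k 1)"
        by (auto simp: vec_eq_iff axis_def fun_eq_iff)
      ultimately show ?thesis by simp
    qed
    have "((\<lambda>w. f (?s w)) has_derivative (\<lambda>c. L (axis k 1) * c)) (at w)"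
      using has_derivative_compose[OF s L(1)] L(2) by (simp add: mult.commute)
    then show ?thesis
      unfolding has_field_derivative_def by blast
  qed
  then show ?thesis
    unfolding holomorphic_on_def field_differentiable_def
    by (meson has_field_derivative_at_within)
qed

subsection \<open>The Poisson formula on the polydisk\<close>

text \<open>The kernel of the circle of radius \<open>r\<close>, not of the unit circle. The factor
  1 / (2 pi) is built in, so that its integral over an angle interval of length 2 pi is 1.\<close>

definition poisson_kernel :: "real \<Rightarrow> complex \<Rightarrow> real \<Rightarrow> real" where
  "poisson_kernel r a s = (r\<^sup>2 - (norm a)\<^sup>2) / (2 * pi * (norm (of_real r * cis s - a))\<^sup>2)"

lemma norm_of_real_cis: "0 \<le> r \<Longrightarrow> norm (of_real r * cis s) = r"
  by (simp add: norm_mult)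

lemma cis_ne_inside: "\<lbrakk>0 < r; norm a < r\<rbrakk> \<Longrightarrow> of_real r * cis s - a \<noteq> 0"
  using norm_of_real_cis[of r s] by force

lemma continuous_on_poisson_kernel:
  "\<lbrakk>0 < r; norm a < r\<rbrakk> \<Longrightarrow> continuous_on S (poisson_kernel r a)"
  unfolding poisson_kernel_def using cis_ne_inside
  by (intro continuous_intros) auto

lemma poisson_kernel_pos:
  assumes "0 < r" "norm a < r"
  shows "0 < poisson_kernel r a s"
proof -
  have "(norm a)\<^sup>2 < r\<^sup>2" using assms by (simp add: power_strict_mono)
  then show ?thesis
    unfolding poisson_kernel_def using cis_ne_inside[OF assms, of s]
    by (intro divide_pos_pos mult_pos_pos zero_less_power) auto
qed

text \<open>Cauchy's formula is applied not to \<open>g\<close> but to \<open>g\<close> times (r^2 -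
  |a|^2) / (r^2 - cnj a * zeta). This factor is 1 at \<open>a\<close>, its pole lies outside the
  closed disc of radius \<open>r\<close>, and on the circle it changes the Cauchy kernel into the
  Poisson kernel.\<close>

lemma has_integral_poisson_kernel:
  assumes g: "g holomorphic_on ball 0 1" and r: "0 < r" "r < 1" and a: "norm a < r"
  shows "((\<lambda>s. poisson_kernel r a s *\<^sub>R g (of_real r * cis s)) has_integral g a) {0..2 * pi}"
proof -
  define f where "f \<zeta> = g \<zeta> * (of_real (r\<^sup>2 - (norm a)\<^sup>2) / (of_real (r\<^sup>2) - cnj a * \<zeta>))" for \<zeta>
  have ne: "of_real (r\<^sup>2) - cnj a * \<zeta> \<noteq> 0" if "norm \<zeta> \<le> r" for \<zeta>
  proof
    assume "of_real (r\<^sup>2) - cnj a * \<zeta> = 0"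
    then have "cnj a * \<zeta> = of_real (r\<^sup>2)" by simp
    then have "norm (cnj a * \<zeta>) = norm (of_real (r\<^sup>2) :: complex)" by (rule arg_cong)
    then have "norm a * norm \<zeta> = r\<^sup>2"
      by (simp add: norm_mult norm_power)
    moreover have "norm a * norm \<zeta> \<le> norm a * r"
      using that by (simp add: mult_left_mono)
    moreover have "norm a * r < r\<^sup>2" using a r by (simp add: power2_eq_square)
    ultimately show False by simp
  qed
  have "f holomorphic_on cball 0 r"
    unfolding f_def using ne r
    by (intro holomorphic_intros holomorphic_on_subset[OF g]) auto
  then have "((\<lambda>\<zeta>. f \<zeta> / (\<zeta> - a)) has_contour_integral (2 * of_real pi * \<i> * f a)) (circlepath 0 r)"
    using a by (intro Cauchy_integral_circlepath_simple) auto
  then have "((\<lambda>t. f (0 + r * cis t) / (0 + r * cis t - a) * r * \<i> * cis t)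
      has_integral (2 * of_real pi * \<i> * f a)) {0..2 * pi}"
    unfolding circlepath_def
    by (subst (asm) has_contour_integral_part_circlepath_iff) auto
  from has_integral_mult_right[OF this, of "1 / (2 * of_real pi * \<i>)"]
  have "((\<lambda>t. 1 / (2 * of_real pi * \<i>) * (f (0 + r * cis t) / (0 + r * cis t - a) * r * \<i> * cis t))
      has_integral f a) {0..2 * pi}" by simp
  moreover have "f a = g a"
  proof -
    have "of_real (r\<^sup>2) - cnj a * a = of_real (r\<^sup>2 - (norm a)\<^sup>2)"
      using complex_norm_square[of a] by (simp add: mult.commute)
    then show ?thesis using ne[of a] a unfolding f_def by simp
  qed
  moreover have "1 / (2 * of_real pi * \<i>) * (f (0 + r * cis t) / (0 + r * cis t - a) * r * \<i> * cis t)
      = poisson_kernel r a t *\<^sub>R g (of_real r * cis t)" for t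
  proof -
    define \<zeta> where "\<zeta> = of_real r * cis t"
    have n: "norm \<zeta> = r" unfolding \<zeta>_def using r by (simp add: norm_of_real_cis)
    have \<zeta>: "\<zeta> \<noteq> 0" "\<zeta> - a \<noteq> 0" using n r a by auto
    \<comment> \<open>On the circle the denominator of the correction factor becomes zeta * cnj
      (zeta - a). Its zeta cancels the one from the differential, and its conjugate factor completes
      the Cauchy denominator to |zeta - a|^2.\<close>
    have sq: "of_real (r\<^sup>2) = \<zeta> * cnj \<zeta>"
      using complex_norm_square[of \<zeta>] n by simp
    have d: "of_real (r\<^sup>2) - cnj a * \<zeta> = \<zeta> * cnj (\<zeta> - a)"
      unfolding sq by (simp add: algebra_simps)
    have m: "of_real ((norm (\<zeta> - a))\<^sup>2) = (\<zeta> - a) * cnj (\<zeta> - a)"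
      by (rule complex_norm_square)
    have c: "cnj (\<zeta> - a) \<noteq> 0" using \<zeta>(2) by (metis complex_cnj_zero_iff)
    have "1 / (2 * of_real pi * \<i>) * (f \<zeta> / (\<zeta> - a) * \<i> * \<zeta>)
       = of_real (r\<^sup>2 - (norm a)\<^sup>2) / (2 * of_real pi * ((\<zeta> - a) * cnj (\<zeta> - a))) * g \<zeta>"
      unfolding f_def d using \<zeta> c by (simp add: field_simps del: complex_cnj_diff)
    also have "\<dots> = of_real (poisson_kernel r a t) * g \<zeta>"
      unfolding poisson_kernel_def \<zeta>_def[symmetric] m[symmetric] by simp
    finally show ?thesis
      unfolding \<zeta>_def by (simp add: scaleR_conv_of_real mult_ac)
  qed
  ultimately show ?thesis by simp
qed

lemma lborel_integral_poisson_kernel: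
  assumes g: "g holomorphic_on ball 0 1" and r: "0 < r" "r < 1" and a: "norm a < r"
  shows "(\<integral>s. (indicator {0..2 * pi} s * poisson_kernel r a s) *\<^sub>R g (of_real r * cis s) \<partial>lborel) = g a"
proof -
  have "continuous_on {0..2 * pi} (\<lambda>s. poisson_kernel r a s *\<^sub>R g (of_real r * cis s))"
    using r a
    by (intro continuous_intros continuous_on_poisson_kernel
        continuous_on_compose2[OF holomorphic_on_imp_continuous_on[OF g]])
       (auto simp: norm_of_real_cis)
  then have "set_integrable lborel {0..2 * pi} (\<lambda>s. poisson_kernel r a s *\<^sub>R g (of_real r * cis s))"
    by (rule borel_integrable_atLeastAtMost')
  from set_borel_integral_eq_integral(2)[OF this] integral_unique[OF has_integral_poisson_kernel[OF assms]]
  show ?thesis by (simp add: set_lebesgue_integral_def)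
qed

section \<open>From the circle to the torus: product measure and Fubini\<close>

abbreviation torus :: "real \<Rightarrow> real ^ 'n \<Rightarrow> complex ^ 'n" where
  "torus r t \<equiv> (\<chi> j. of_real r * cis (t $ j))"

abbreviation angles :: "(real ^ 'n) set" where
  "angles \<equiv> cbox 0 (\<chi> j. 2 * pi)"

interpretation lborel_product: product_sigma_finite "\<lambda>j. lborel :: real measure"
  by standard

lemma borel_measurable_vec_lambda:
  fixes f :: "'i :: finite \<Rightarrow> 'b \<Rightarrow> 'a :: euclidean_space"
  assumes "\<And>j. f j \<in> borel_measurable M"
  shows "(\<lambda>x. \<chi> j. f j x) \<in> borel_measurable M"
  unfolding borel_measurable_euclidean_space[where 'c = "'a ^ 'i"]
proof
  fix b :: "'a ^ 'i" assume "b \<in> Basis"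
  then obtain i c where "b = axis i c" by (auto simp: Basis_vec_def)
  then show "(\<lambda>x. (\<chi> j. f j x) \<bullet> b) \<in> borel_measurable M"
    using assms by (simp add: inner_axis)
qed

text \<open>Both measures give a box the product of its side lengths, and this determines Lebesgue
  measure. Integrals over vectors can then be computed on the product space, where Fubini allows
  induction on the set of coordinates.\<close>

lemma lborel_vec_eq_distr_PiM:
  "(lborel :: (real ^ 'n) measure) = distr (PiM UNIV (\<lambda>j :: 'n. lborel)) borel (\<lambda>x. \<chi> j. x j)"
proof (rule lborel_eqI)
  have meas [measurable]:
    "(\<lambda>x. (\<chi> j. x j) :: real ^ 'n) \<in> borel_measurable (PiM UNIV (\<lambda>j :: 'n. lborel))"
    by (intro borel_measurable_vec_lambda) measurable
  fix l u :: "real ^ 'n" assume le: "\<And>b. b \<in> Basis \<Longrightarrow> l \<bullet> b \<le> u \<bullet> b"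
  have le': "l $ j \<le> u $ j" for j
    using le[of "axis j 1"] by (simp add: inner_axis axis_in_Basis_iff)
  have "emeasure (distr (PiM UNIV (\<lambda>j :: 'n. lborel)) borel (\<lambda>x. \<chi> j. x j)) (box l u)
      = emeasure (PiM UNIV (\<lambda>j :: 'n. lborel)) (PiE UNIV (\<lambda>j. {l $ j <..< u $ j}))"
    by (subst emeasure_distr)
       (auto simp: space_PiM mem_box_cart PiE_def Pi_def intro!: arg_cong[where f = "emeasure _"])
  also have "\<dots> = (\<Prod>j\<in>UNIV. ennreal (u $ j - l $ j))"
    using le' by (subst lborel_product.emeasure_PiM) auto
  also have "\<dots> = ennreal (\<Prod>j\<in>UNIV. u $ j - l $ j)"
    using le' by (intro prod_ennreal) auto
  also have "(\<Prod>j\<in>UNIV. u $ j - l $ j) = (\<Prod>b\<in>Basis. (u - l) \<bullet> b)"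
  proof -
    have B: "(Basis :: (real ^ 'n) set) = (\<lambda>j. axis j 1) ` UNIV"
      by (auto simp: Basis_vec_def)
    have "inj (\<lambda>j. axis j 1 :: real ^ 'n)"
      by (auto intro!: injI simp: axis_eq_axis)
    then show ?thesis
      unfolding B by (simp add: prod.reindex inner_axis)
  qed
  finally show "emeasure (distr (PiM UNIV (\<lambda>j :: 'n. lborel)) borel (\<lambda>x. \<chi> j. x j)) (box l u)
      = ennreal (\<Prod>b\<in>Basis. (u - l) \<bullet> b)" .
qed simp

lemma compact_closed_polydisk: "compact {v :: complex ^ 'n. \<forall>j. norm (v $ j) \<le> s}"
proof (rule compact_eq_bounded_closed[THEN iffD2], intro conjI)
  show "bounded {v :: complex ^ 'n. \<forall>j. norm (v $ j) \<le> s}"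
    unfolding bounded_iff
  proof (intro exI ballI)
    fix v :: "complex ^ 'n" assume "v \<in> {v. \<forall>j. norm (v $ j) \<le> s}"
    then have "(\<Sum>j\<in>UNIV. norm (v $ j)) \<le> (\<Sum>j\<in>(UNIV :: 'n set). s)"
      by (intro sum_mono) auto
    moreover have "norm v \<le> (\<Sum>j\<in>UNIV. norm (v $ j))"
      unfolding norm_vec_def by (rule L2_set_le_sum) auto
    ultimately show "norm v \<le> (\<Sum>j\<in>(UNIV :: 'n set). s)" by linarith
  qed
  have eq: "{v :: complex ^ 'n. \<forall>j. norm (v $ j) \<le> s} = (\<Inter>j. {v. norm (v $ j) \<le> s})"
    by auto
  show "closed {v :: complex ^ 'n. \<forall>j. norm (v $ j) \<le> s}"
    unfolding eq by (intro closed_INT ballI closed_Collect_le continuous_intros)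
qed

text \<open>Supplies the integrability that Fubini demands at each stage of the induction below. All
  arguments of \<open>u\<close> stay in one compact polydisk, so \<open>u\<close> is bounded there
  and the product of the integrable weights dominates.\<close>

lemma integrable_PiM_weighted:
  fixes u :: "complex ^ 'n \<Rightarrow> complex" and z :: "complex ^ 'n" and w :: "'n \<Rightarrow> real \<Rightarrow> real"
  assumes u: "continuous_on polydisk u" and r: "0 < r" "r < 1" and z: "z \<in> polydisk"
    and w: "\<And>j. integrable lborel (w j)"
  shows "integrable (PiM I (\<lambda>j. lborel))
    (\<lambda>x. (\<Prod>j\<in>I. w j (x j)) *\<^sub>R u (\<chi> j. if j \<in> I then of_real r * cis (x j) else z $ j))"
proof -
  define v where "v x = (\<chi> j. if j \<in> I then of_real r * cis (x j) else z $ j)" for x :: "'n \<Rightarrow> real"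
  \<comment> \<open>The closed polydisk of radius \<open>s\<close> contains points with coordinates
    on the circle of radius \<open>r\<close> as well as points with coordinates frozen at
    \<open>z\<close>.\<close>
  define s where "s = Max (insert r (range (\<lambda>j. norm (z $ j))))"
  let ?K = "{v :: complex ^ 'n. \<forall>j. norm (v $ j) \<le> s}"
  have fin: "finite (insert r (range (\<lambda>j. norm (z $ j))))" by simp
  have "\<forall>y\<in>insert r (range (\<lambda>j. norm (z $ j))). y < 1"
    using r z by (auto simp: polydisk_def)
  then have s1: "s < 1"
    unfolding s_def using Max_in[OF fin] by blast
  have K: "?K \<subseteq> polydisk"
  proof
    fix v assume "v \<in> ?K"
    then have "norm (v $ j) < 1" for j
      using s1 le_less_trans[of "norm (v $ j)" s 1] by simp
    then show "v \<in> polydisk" by (simp add: polydisk_def)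
  qed
  have rs: "r \<le> s"
    unfolding s_def by (rule Max_ge[OF fin]) simp
  have zs: "norm (z $ j) \<le> s" for j
    unfolding s_def by (rule Max_ge[OF fin]) simp
  have vK: "v x \<in> ?K" for x
  proof -
    have "norm (v x $ j) \<le> s" for j
      using rs zs[of j] r norm_of_real_cis[of r "x j"] by (cases "j \<in> I") (simp_all add: v_def)
    then show ?thesis by simp
  qed
  have "compact (u ` ?K)"
    by (rule compact_continuous_image[OF continuous_on_subset[OF u K] compact_closed_polydisk])
  from compact_imp_bounded[OF this, unfolded bounded_iff]
  obtain B where B: "\<forall>y\<in>u ` ?K. norm y \<le> B"
    by (rule exE)
  have uB: "norm (u (v x)) \<le> B" for x
    by (rule bspec[OF B imageI[OF vK]])
  have "(\<lambda>x. v x) \<in> borel_measurable (PiM I (\<lambda>j. lborel))"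
    unfolding v_def
  proof (rule borel_measurable_vec_lambda)
    fix j show "(\<lambda>x. if j \<in> I then of_real r * cis (x j) else z $ j)
        \<in> borel_measurable (PiM I (\<lambda>j. lborel))"
    proof (cases "j \<in> I")
      case True
      have "cis \<in> borel_measurable lborel"
        using borel_measurable_continuous_onI[of cis] by (simp add: continuous_on_cis continuous_on_id)
      from measurable_compose[OF measurable_component_singleton[OF True] this]
      have "(\<lambda>x. cis (x j)) \<in> borel_measurable (PiM I (\<lambda>j. lborel))" .
      with True show ?thesis by simp
    qed simp
  qed
  \<comment> \<open>Continuity of \<open>u\<close> is known on the polydisk only, so measurability
    is shown for \<open>u\<close> cut off outside it. The cut-off does nothing at the points
    \<open>v x\<close>.\<close>
  moreover have "(\<lambda>x. indicator polydisk x *\<^sub>R u x) \<in> borel_measurable borel"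
    by (rule borel_measurable_continuous_on_indicator[OF borel_open[OF open_polydisk] u])
  ultimately have *: "(\<lambda>x. indicator polydisk (v x) *\<^sub>R u (v x)) \<in> borel_measurable (PiM I (\<lambda>j. lborel))"
    by (rule measurable_compose)
  then have um: "(\<lambda>x. u (v x)) \<in> borel_measurable (PiM I (\<lambda>j. lborel))"
  proof -
    have "v x \<in> polydisk" for x using K vK by (rule subsetD)
    then show ?thesis using * by simp
  qed
  have prod: "integrable (PiM I (\<lambda>j. lborel)) (\<lambda>x. \<Prod>j\<in>I. w j (x j))"
    using w by (intro lborel_product.product_integrable_prod) auto
  show ?thesis
    unfolding v_def[symmetric]
  proof (rule Bochner_Integration.integrable_bound[OF integrable_mult_left[OF prod, of B]])
    show "(\<lambda>x. (\<Prod>j\<in>I. w j (x j)) *\<^sub>R u (v x)) \<in> borel_measurable (PiM I (\<lambda>j. lborel))"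
      using um borel_measurable_integrable[OF prod] by simp
    have "\<bar>\<Prod>j\<in>I. w j (x j)\<bar> * norm (u (v x)) \<le> \<bar>\<Prod>j\<in>I. w j (x j)\<bar> * \<bar>B\<bar>" for x
      using uB[of x] by (intro mult_left_mono) auto
    then show "AE x in PiM I (\<lambda>j. lborel).
        norm ((\<Prod>j\<in>I. w j (x j)) *\<^sub>R u (v x)) \<le> norm ((\<Prod>j\<in>I. w j (x j)) * B)"
      by (simp add: abs_mult)
  qed
qed

text \<open>Induction on the set \<open>I\<close> of coordinates that run over circles, the others
  being frozen at \<open>z\<close>. For empty \<open>I\<close> the integral is the value at
  \<open>z\<close>; each further coordinate is integrated out by the one-variable formula.\<close>

lemma PiM_integral_poisson_kernel:
  fixes u :: "complex ^ 'n \<Rightarrow> complex" and z :: "complex ^ 'n"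
  assumes u: "u holomorphic_vec_on polydisk" and r: "0 < r" "r < 1" and z: "\<And>j. norm (z $ j) < r"
  shows "(\<integral>x. (\<Prod>j\<in>I. indicator {0..2 * pi} (x j) * poisson_kernel r (z $ j) (x j)) *\<^sub>R
            u (\<chi> j. if j \<in> I then of_real r * cis (x j) else z $ j) \<partial>PiM I (\<lambda>j. lborel)) = u z"
proof -
  let ?w = "\<lambda>j s. indicator {0..2 * pi} s * poisson_kernel r (z $ j) s"
  let ?v = "\<lambda>I x. \<chi> j. if j \<in> I then of_real r * cis (x j) else z $ j"
  have zp: "z \<in> polydisk"
    unfolding polydisk_def using z r less_trans by blast
  have w: "integrable lborel (?w j)" for j
    using borel_integrable_compact[OF compact_Icc continuous_on_poisson_kernel[OF r(1) z]] by simp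
  have "finite I" by simp
  then show ?thesis
  proof (induction I rule: finite_induct)
    case empty
    show ?case by (simp add: PiM_empty lebesgue_integral_count_space_finite)
  next
    case (insert i I)
    have inner: "(\<integral>y. (\<Prod>j\<in>insert i I. ?w j ((x(i := y)) j)) *\<^sub>R u (?v (insert i I) (x(i := y))) \<partial>lborel)
        = (\<Prod>j\<in>I. ?w j (x j)) *\<^sub>R u (?v I x)" for x
    proof -
      have P: "(\<Prod>j\<in>insert i I. ?w j ((x(i := y)) j)) = (\<Prod>j\<in>I. ?w j (x j)) * ?w i y" for y
      proof -
        have "(\<Prod>j\<in>I. ?w j ((x(i := y)) j)) = (\<Prod>j\<in>I. ?w j (x j))"
          using insert.hyps by (intro prod.cong) auto
        then show ?thesis using insert.hyps by simp
      qed
      have S: "?v (insert i I) (x(i := y)) = (\<chi> j. if j = i then of_real r * cis y else ?v I x $ j)" for y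
        by (auto simp: vec_eq_iff)
      have "(\<lambda>w. u (\<chi> j. if j = i then w else ?v I x $ j)) holomorphic_on ball 0 1"
        using r zp by (intro holomorphic_vec_on_slice[OF u])
          (auto simp: norm_of_real_cis polydisk_def)
      from lborel_integral_poisson_kernel[OF this r z[of i]]
      have "(\<integral>y. ?w i y *\<^sub>R u (\<chi> j. if j = i then of_real r * cis y else ?v I x $ j) \<partial>lborel)
          = u (\<chi> j. if j = i then z $ i else ?v I x $ j)" .
      also have "(\<chi> j. if j = i then z $ i else ?v I x $ j) = ?v I x"
        using insert.hyps by (auto simp: vec_eq_iff)
      finally show ?thesis
        unfolding P S scaleR_scaleR[symmetric] by (simp only: integral_scaleR_right)
    qed
    show ?case
      by (subst lborel_product.product_integral_insert[OF insert.hyps(1,2)])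
         (intro integrable_PiM_weighted holomorphic_vec_on_imp_continuous_on u r zp w,
          simp only: inner insert.IH)
  qed
qed

definition poisson_weight :: "real \<Rightarrow> complex ^ 'n \<Rightarrow> real ^ 'n \<Rightarrow> real" where
  "poisson_weight r z t = (\<Prod>j\<in>UNIV. poisson_kernel r (z $ j) (t $ j))"

lemma poisson_weight_integral:
  fixes u :: "complex ^ 'n \<Rightarrow> complex" and z :: "complex ^ 'n"
  assumes u: "u holomorphic_vec_on polydisk" and r: "0 < r" "r < 1" and z: "\<And>j. norm (z $ j) < r"
  shows "(LINT t : angles | lborel. poisson_weight r z t *\<^sub>R u (torus r t)) = u z"
proof -
  let ?F = "\<lambda>t. indicator angles t *\<^sub>R (poisson_weight r z t *\<^sub>R u (torus r t))"
  have cont: "continuous_on angles (\<lambda>t. poisson_weight r z t *\<^sub>R u (torus r t))"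
    unfolding poisson_weight_def using r z
    by (intro continuous_intros continuous_on_compose2[OF continuous_on_poisson_kernel]
        continuous_on_compose2[OF holomorphic_vec_on_imp_continuous_on[OF u]])
       (auto simp: polydisk_def norm_of_real_cis)
  have F: "?F \<in> borel_measurable borel"
    by (rule borel_measurable_continuous_on_indicator[OF _ cont]) simp
  \<comment> \<open>The indicator of the cube factors, so it can be absorbed into the
    one-dimensional weights of the product formula.\<close>
  have ind: "indicator angles (\<chi> j. x j) = (\<Prod>j\<in>UNIV. indicator {0..2 * pi} (x j) :: real)"
    for x :: "'n \<Rightarrow> real"
    by (auto simp: indicator_def mem_box_cart prod_zero_iff)
  have "(LINT t : angles | lborel. poisson_weight r z t *\<^sub>R u (torus r t))
      = (\<integral>t. ?F t \<partial>distr (PiM UNIV (\<lambda>j. lborel)) borel (\<lambda>x. \<chi> j. x j))"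
    unfolding set_lebesgue_integral_def lborel_vec_eq_distr_PiM[symmetric] ..
  also have "\<dots> = (\<integral>x. ?F (\<chi> j. x j) \<partial>PiM UNIV (\<lambda>j. lborel))"
    by (intro integral_distr F borel_measurable_vec_lambda) measurable
  also have "\<dots> = u z"
    using PiM_integral_poisson_kernel[OF u r z, of UNIV]
    unfolding ind poisson_weight_def by (simp add: prod.distrib)
  finally show ?thesis .
qed

subsection \<open>A quantitative form of strict convexity\<close>

text \<open>The height of the convex function |x|^p on the plane above its real-linear tangent at
  1.\<close>

definition powr_gap :: "real \<Rightarrow> complex \<Rightarrow> real" where
  "powr_gap p x = norm x powr p - 1 - p * (Re x - 1)"

text \<open>Bernoulli's inequality with its equality case. For t > 0, t^p = t exp ((p - 1) ln t) is
  at least t (1 + (p - 1) ln t); strictness comes from t ln t > t - 1, which is ln s < s - 1 at s =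
  1 / t.\<close>

lemma powr_tangent_le:
  fixes t p :: real
  assumes "1 < p" "0 \<le> t"
  shows "1 + p * (t - 1) \<le> t powr p"
    and "t \<noteq> 1 \<Longrightarrow> 1 + p * (t - 1) < t powr p"
proof -
  have strict: "1 + p * (t - 1) < t powr p" if "t \<noteq> 1"
  proof (cases "t = 0")
    case False
    with assms have t: "t > 0" by simp
    have "ln (1 / t) < 1 / t - 1"
      using ln_le_minus_one[of "1 / t"] ln_eq_minus_one[of "1 / t"] t that by fastforce
    then have "t * - ln t < t * (1 / t - 1)"
      using t by (intro mult_strict_left_mono) (auto simp: ln_div)
    then have "t - 1 < t * ln t"
      using t by (simp add: algebra_simps)
    then have "(p - 1) * (t - 1) < (p - 1) * (t * ln t)"
      using assms by simp
    then have "1 + p * (t - 1) < t * (1 + (p - 1) * ln t)"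
      by (simp add: algebra_simps)
    also have "\<dots> \<le> t * exp ((p - 1) * ln t)"
      using t by (intro mult_left_mono exp_ge_add_one_self) auto
    also have "\<dots> = t powr p"
      using t by (simp add: powr_def exp_diff[symmetric] exp_add[symmetric] algebra_simps exp_diff)
    finally show ?thesis .
  qed (use assms in auto)
  then show "t \<noteq> 1 \<Longrightarrow> 1 + p * (t - 1) < t powr p" .
  show "1 + p * (t - 1) \<le> t powr p"
    using strict by (cases "t = 1") auto
qed

lemma powr_gap_nonneg: "1 < p \<Longrightarrow> 0 \<le> powr_gap p x"
proof -
  assume p: "1 < p"
  have "p * (Re x - 1) \<le> p * (norm x - 1)"
    using p complex_Re_le_cmod[of x] by (intro mult_left_mono) auto
  then show ?thesis
    using powr_tangent_le(1)[OF p, of "norm x"] by (simp add: powr_gap_def)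
qed

text \<open>Strictness has two sources. Off the unit circle it is the strict Bernoulli inequality
  for |x|; on the unit circle it is Re x < 1, since 1 is the only unimodular number with real part
  1.\<close>

lemma powr_gap_pos:
  assumes p: "1 < p" and x: "x \<noteq> 1"
  shows "0 < powr_gap p x"
proof (cases "norm x = 1")
  case False
  have "p * (Re x - 1) \<le> p * (norm x - 1)"
    using p complex_Re_le_cmod[of x] by (intro mult_left_mono) auto
  then show ?thesis
    using powr_tangent_le(2)[OF p, of "norm x"] False by (simp add: powr_gap_def)
next
  case True
  have "Re x \<noteq> 1"
  proof
    assume "Re x = 1"
    moreover have "(Re x)\<^sup>2 + (Im x)\<^sup>2 = 1"
      using True cmod_power2[of x] by simp
    ultimately show False using x by (simp add: complex_eq_iff)
  qed
  then have "Re x < 1" using complex_Re_le_cmod[of x] True by simp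
  then have "p * (Re x - 1) < 0" using p by (intro mult_pos_neg) auto
  then show ?thesis using True by (simp add: powr_gap_def)
qed

lemma powr_convex_combination:
  fixes t p c :: real
  assumes "1 < p" "0 \<le> t" "0 \<le> c" "c < 1"
  shows "((1 - c) + c * t) powr p \<le> (1 - c) + c * t powr p"
proof (cases "t = 0")
  case True
  have "(1 - c) powr p \<le> (1 - c) powr 1"
    using assms by (intro powr_mono') auto
  then show ?thesis using True assms by simp
next
  case False
  then show ?thesis
    using convex_onD[OF powr_convex, of p c 1 t] assms by simp
qed

text \<open>
  On the circle of radius \<open>e\<close> around 1 the gap has a positive minimum, and by convexity it grows at
  least linearly along rays starting at 1.
\<close>

lemma norm_diff_le_powr_gap:
  assumes p: "1 < p" and e: "0 < e"
  shows "\<exists>C\<ge>0. \<forall>x. norm (x - 1) \<le> e + C * powr_gap p x"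
proof -
  have "continuous_on (sphere 1 e) (powr_gap p)"
    unfolding powr_gap_def using p by (intro continuous_intros continuous_on_powr') auto
  then obtain y0 where y0: "y0 \<in> sphere 1 e" "\<And>y. y \<in> sphere 1 e \<Longrightarrow> powr_gap p y0 \<le> powr_gap p y"
    using continuous_attains_inf[of "sphere 1 e" "powr_gap p"] e by auto
  define c where "c = powr_gap p y0"
  have c: "c > 0"
    unfolding c_def using y0(1) e p by (intro powr_gap_pos) auto
  have "norm (x - 1) \<le> e + e / c * powr_gap p x" for x
  proof (cases "norm (x - 1) \<le> e")
    case True
    then show ?thesis
      using powr_gap_nonneg[OF p, of x] c e by (intro add_increasing2) auto
  next
    case False
    \<comment> \<open>With this ratio, \<open>y\<close> is the point where the segment from 1 to
      \<open>x\<close> crosses the circle of radius \<open>e\<close> around 1.\<close>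
    define d where "d = e / norm (x - 1)"
    have d: "0 < d" "d < 1" using False e less_trans[of 0 e "norm (x - 1)"] unfolding d_def by (simp_all del: zero_less_norm_iff)
    define y where "y = 1 + of_real d * (x - 1)"
    have "norm (y - 1) = e"
      unfolding y_def using d(1) False e by (auto simp: norm_mult norm_divide d_def)
    then have "c \<le> powr_gap p y"
      unfolding c_def by (intro y0(2)) (simp add: dist_norm norm_minus_commute)
    \<comment> \<open>The tangent term scales exactly by \<open>d\<close> along the ray, since y - 1
      = d (x - 1); the power term is bounded by its chord through convexity.\<close>
    also have "\<dots> \<le> d * powr_gap p x"
    proof -
      have "y = of_real (1 - d) + of_real d * x" unfolding y_def by (simp add: algebra_simps)
      then have "norm y \<le> norm (of_real (1 - d) :: complex) + norm (of_real d * x)"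
        by (metis norm_triangle_ineq)
      also have "\<dots> = (1 - d) + d * norm x"
        using d by (simp add: norm_mult del: of_real_diff)
      finally have "norm y powr p \<le> ((1 - d) + d * norm x) powr p"
        using p by (intro powr_mono2) auto
      also have "\<dots> \<le> (1 - d) + d * norm x powr p"
        using p d by (intro powr_convex_combination) auto
      finally show ?thesis
        unfolding powr_gap_def y_def by (simp add: algebra_simps)
    qed
    finally have "c \<le> e * powr_gap p x / norm (x - 1)"
      by (simp add: d_def)
    moreover have "0 < norm (x - 1)" using False e by linarith
    ultimately have "c * norm (x - 1) \<le> e * powr_gap p x"
      by (simp only: pos_le_divide_eq)
    then have "norm (x - 1) \<le> e / c * powr_gap p x"
      using c by (simp add: field_simps)
    then show ?thesis using e by simp
  qed
  then show ?thesis
    using c e by (intro exI[of _ "e / c"]) simp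
qed

text \<open>Where |x| > e, write |x| = |x|^(1 - p) |x|^p and use that 1 - p is negative. This serves
  the case \<open>w0 = 0\<close>, where no quotient by the extremal function exists.\<close>

lemma norm_le_powr:
  fixes x :: complex
  assumes p: "1 < p" and e: "0 < e"
  shows "norm x \<le> e + e powr (1 - p) * norm x powr p"
proof (cases "norm x \<le> e")
  case False
  with e have x: "norm x > 0" by linarith
  have "e powr (1 - p) * e powr (p - 1) = 1"
    using e by (simp add: powr_add[symmetric])
  then have "norm x = e powr (1 - p) * (e powr (p - 1) * norm x)"
    by (simp add: mult.assoc[symmetric])
  also have "\<dots> \<le> e powr (1 - p) * (norm x powr (p - 1) * norm x)"
    using False e p by (intro mult_left_mono mult_right_mono powr_mono2) auto
  also have "norm x powr (p - 1) * norm x = norm x powr p"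
    using x by (simp add: powr_diff)
  finally show ?thesis using e by simp
qed (simp add: add_increasing2)

subsection \<open>Poisson averages and Hardy means\<close>

abbreviation angle_integral :: "(real ^ 'n \<Rightarrow> 'b) \<Rightarrow> 'b :: {banach, second_countable_topology}" where
  "angle_integral g \<equiv> (LINT t : angles | lborel. g t)"

lemma set_integrable_angles:
  fixes g :: "real ^ 'n \<Rightarrow> 'b :: {banach, second_countable_topology}"
  assumes "continuous_on UNIV g"
  shows "set_integrable lborel angles g"
  unfolding set_integrable_def
  by (rule borel_integrable_compact[OF compact_cbox continuous_on_subset[OF assms subset_UNIV]])

lemma angle_integral_mono:
  fixes f g :: "real ^ 'n \<Rightarrow> real"
  assumes "continuous_on UNIV f" "continuous_on UNIV g" "\<And>t. f t \<le> g t"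
  shows "angle_integral f \<le> angle_integral g"
  using assms by (intro set_integral_mono set_integrable_angles) auto

lemma torus_in_polydisk: "\<lbrakk>0 < r; r < 1\<rbrakk> \<Longrightarrow> torus r t \<in> polydisk"
  by (simp add: polydisk_def norm_of_real_cis)

lemma continuous_on_torus:
  assumes "continuous_on polydisk f" "0 < r" "r < 1"
  shows "continuous_on UNIV (\<lambda>t. f (torus r t))"
  by (rule continuous_on_compose2[OF assms(1)])
     (auto intro!: continuous_intros torus_in_polydisk assms(2,3))

lemma continuous_on_poisson_weight:
  "\<lbrakk>0 < r; \<And>j. norm (z $ j) < r\<rbrakk> \<Longrightarrow> continuous_on UNIV (poisson_weight r z)"
  unfolding poisson_weight_def
  by (intro continuous_intros continuous_on_compose2[OF continuous_on_poisson_kernel[of r _ UNIV]]) auto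

lemma poisson_weight_pos:
  "\<lbrakk>0 < r; \<And>j. norm (z $ j) < r\<rbrakk> \<Longrightarrow> 0 < poisson_weight r z t"
  unfolding poisson_weight_def by (intro prod_pos ballI poisson_kernel_pos) auto

lemma angle_integral_poisson_weight:
  fixes z :: "complex ^ 'n"
  assumes r: "0 < r" "r < 1" and z: "\<And>j. norm (z $ j) < r"
  shows "angle_integral (poisson_weight r z) = 1"
proof -
  have "complex_of_real (angle_integral (poisson_weight r z))
      = angle_integral (\<lambda>t. poisson_weight r z t *\<^sub>R (1 :: complex))"
    by (simp add: scaleR_conv_of_real set_integral_complex_of_real)
  also have "\<dots> = 1"
    by (rule poisson_weight_integral[OF holomorphic_vec_on_const r z])
  finally show ?thesis by simp
qed

text \<open>A Harnack-type comparison whose constant depends on neither \<open>r\<close> nor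
  \<open>s\<close>. For \<open>z\<close> the numerator is at most 1 and the distance to the circle
  at least r0 - |z|; for \<open>a\<close> the numerator is at least r0^2 - |a|^2 and the distance at
  most 2, whose square is the 4.\<close>

lemma poisson_kernel_le:
  assumes r0: "0 < r0" "norm a < r0" "norm z < r0" and r: "r0 < r" "r < 1"
  shows "poisson_kernel r z s \<le> 4 / ((r0\<^sup>2 - (norm a)\<^sup>2) * (r0 - norm z)\<^sup>2) * poisson_kernel r a s"
proof -
  let ?e = "of_real r * cis s"
  have e: "norm ?e = r" using r0 r by (simp add: norm_of_real_cis)
  have "r0 - norm z \<le> norm (?e - z)"
    using norm_triangle_ineq2[of ?e z] e r by linarith
  then have z: "(r0 - norm z)\<^sup>2 \<le> (norm (?e - z))\<^sup>2"
    using r0 by (intro power_mono) auto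
  have z0: "(r0 - norm z)\<^sup>2 > 0" using r0 by simp
  have "norm (?e - a) \<le> 2"
    using norm_triangle_ineq4[of ?e a] e r0 r by linarith
  then have a: "(norm (?e - a))\<^sup>2 \<le> 4"
    using power_mono[of "norm (?e - a)" 2 2] by simp
  have a1: "(norm (?e - a))\<^sup>2 > 0"
    using cis_ne_inside[of r a s] r0 r by simp
  have a0: "r0\<^sup>2 - (norm a)\<^sup>2 > 0" "r0\<^sup>2 - (norm a)\<^sup>2 \<le> r\<^sup>2 - (norm a)\<^sup>2"
    using r0 r by (auto intro: power_strict_mono power_mono)
  have r1: "r\<^sup>2 - (norm z)\<^sup>2 \<le> 1"
    using r r0 power_le_one[of r 2] by (smt (verit) zero_le_power2)
  have "poisson_kernel r z s \<le> 1 / (2 * pi * (r0 - norm z)\<^sup>2)"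
    unfolding poisson_kernel_def using z z0 r1
    by (intro frac_le mult_left_mono mult_pos_pos) auto
  also have "\<dots> = 4 / ((r0\<^sup>2 - (norm a)\<^sup>2) * (r0 - norm z)\<^sup>2) * ((r0\<^sup>2 - (norm a)\<^sup>2) / (2 * pi * 4))"
  proof -
    have *: "1 / (2 * pi * y) = 4 / (x * y) * (x / (2 * pi * 4))" if "x \<noteq> 0" for x y :: real
      using that by (cases "y = 0") (auto simp: field_simps)
    show ?thesis using a0(1) by (intro *) simp
  qed
  also have "\<dots> \<le> 4 / ((r0\<^sup>2 - (norm a)\<^sup>2) * (r0 - norm z)\<^sup>2) * poisson_kernel r a s"
    unfolding poisson_kernel_def using a a0 a1 z0
    by (intro mult_left_mono frac_le mult_pos_pos divide_nonneg_nonneg mult_nonneg_nonneg) auto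
  finally show ?thesis .
qed

lemma exists_radius:
  fixes z a :: "complex ^ 'n"
  assumes "z \<in> polydisk" "a \<in> polydisk"
  shows "\<exists>r0>0. r0 < 1 \<and> (\<forall>j. norm (z $ j) < r0) \<and> (\<forall>j. norm (a $ j) < r0)"
proof -
  define A where "A = insert 0 (range (\<lambda>j. norm (z $ j)) \<union> range (\<lambda>j. norm (a $ j)))"
  have fin: "finite A" unfolding A_def by simp
  have "\<forall>y\<in>A. y < 1"
    using assms by (auto simp: polydisk_def A_def)
  then have "Max A < 1"
    using Max_in[OF fin] by (auto simp: A_def)
  then obtain r0 where r0: "Max A < r0" "r0 < 1" using dense by metis
  have "y < r0" if "y \<in> A" for y
    using Max_ge[OF fin that] r0 by linarith
  then show ?thesis
    using r0(2) by (intro exI[of _ r0]) (simp add: A_def)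
qed

text \<open>By the Poisson formula |g z| is at most the average of |g| weighted for
  \<open>z\<close>, and kernel comparison bounds that by \<open>K\<close> times the average weighted
  for \<open>a\<close>. As \<open>K\<close> does not depend on \<open>r\<close>, letting
  \<open>r\<close> tend to 1 settles every point \<open>z\<close> at once.\<close>

lemma holomorphic_vec_on_eq_zero:
  fixes g :: "complex ^ 'n \<Rightarrow> complex"
  assumes g: "g holomorphic_vec_on polydisk" and a: "a \<in> polydisk" and z: "z \<in> polydisk"
    and lim: "((\<lambda>r. angle_integral (\<lambda>t. poisson_weight r a t * norm (g (torus r t)))) \<longlongrightarrow> 0) (at_left 1)"
  shows "g z = 0"
proof -
  obtain r0 where r0: "0 < r0" "r0 < 1" "\<And>j. norm (z $ j) < r0" "\<And>j. norm (a $ j) < r0"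
    using exists_radius[OF z a] by blast
  define K where "K = (\<Prod>j\<in>UNIV. 4 / ((r0\<^sup>2 - (norm (a $ j))\<^sup>2) * (r0 - norm (z $ j))\<^sup>2))"
  have bound: "norm (g z) \<le> K * angle_integral (\<lambda>t. poisson_weight r a t * norm (g (torus r t)))"
    if r: "r0 < r" "r < 1" for r
  proof -
    have r': "0 < r" and zr: "\<And>j. norm (z $ j) < r" and ar: "\<And>j. norm (a $ j) < r"
      using r r0 less_trans by blast+
    have cg: "continuous_on UNIV (\<lambda>t. g (torus r t))"
      by (rule continuous_on_torus[OF holomorphic_vec_on_imp_continuous_on[OF g] r' r(2)])
    note cont = cg continuous_on_poisson_weight[of r z, OF r' zr] continuous_on_poisson_weight[of r a, OF r' ar]
    have "norm (g z) = norm (angle_integral (\<lambda>t. poisson_weight r z t *\<^sub>R g (torus r t)))"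
      using poisson_weight_integral[OF g r' r(2) zr] by simp
    also have "\<dots> \<le> angle_integral (\<lambda>t. norm (poisson_weight r z t *\<^sub>R g (torus r t)))"
      by (intro set_integral_norm_bound set_integrable_angles continuous_intros cont)
    also have "\<dots> \<le> angle_integral (\<lambda>t. K * (poisson_weight r a t * norm (g (torus r t))))"
    proof (intro angle_integral_mono continuous_intros cont)
      fix t
      have "poisson_weight r z t \<le> K * poisson_weight r a t"
        unfolding poisson_weight_def K_def prod.distrib[symmetric]
        using r r0 r' zr
        by (intro prod_mono conjI poisson_kernel_le less_imp_le[OF poisson_kernel_pos]) auto
      then show "norm (poisson_weight r z t *\<^sub>R g (torus r t)) \<le> K * (poisson_weight r a t * norm (g (torus r t)))"
        using poisson_weight_pos[of r z t, OF r' zr]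
        by (simp add: mult.assoc[symmetric] mult_right_mono)
    qed
    also have "\<dots> = K * angle_integral (\<lambda>t. poisson_weight r a t * norm (g (torus r t)))"
      by simp
    finally show ?thesis .
  qed
  have "eventually (\<lambda>r. r \<in> {r0<..<1}) (at_left 1)"
    by (rule eventually_at_leftI[OF _ r0(2)]) auto
  then have "eventually (\<lambda>r. norm (g z)
      \<le> K * angle_integral (\<lambda>t. poisson_weight r a t * norm (g (torus r t)))) (at_left 1)"
    by eventually_elim (rule bound, auto)
  from tendsto_lowerbound[OF tendsto_mult_right_zero[OF lim, of K] this]
  show ?thesis by simp
qed

section \<open>Integral means before taking the root, and the Hardy norm\<close>

definition mean_power :: "real \<Rightarrow> (complex ^ 'n \<Rightarrow> complex) \<Rightarrow> real \<Rightarrow> real" where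
  "mean_power p f r = 1 / (2 * pi) ^ CARD('n) * angle_integral (\<lambda>t :: real ^ 'n. norm (f (torus r t)) powr p)"

lemma hardy_mean_eq: "hardy_mean p f r = mean_power p f r powr (1 / p)"
  by (simp add: hardy_mean_def mean_power_def)

lemma mean_power_nonneg: "0 \<le> mean_power p f r"
  unfolding mean_power_def set_lebesgue_integral_def
  by (intro mult_nonneg_nonneg Bochner_Integration.integral_nonneg) auto

lemma hardy_norm_nonneg: 
  assumes "f \<in> hardy_space p"
  shows "0 \<le> hardy_norm p f"
proof -
  have "0 \<le> hardy_mean p f (1/2)" by (simp add: hardy_mean_eq)
  also have "\<dots> \<le> hardy_norm p f"
    using assms unfolding hardy_norm_def hardy_space_def by (intro cSUP_upper) auto
  finally show ?thesis .
qed

lemma mean_power_le: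
  assumes p: "1 < p" and f: "f \<in> hardy_space p" and r: "0 < r" "r < 1"
  shows "mean_power p f r \<le> hardy_norm p f powr p"
proof -
  have "hardy_mean p f r \<le> hardy_norm p f"
    using f r unfolding hardy_norm_def hardy_space_def by (intro cSUP_upper) auto
  then have "(mean_power p f r powr (1 / p)) powr p \<le> hardy_norm p f powr p"
    unfolding hardy_mean_eq using p by (intro powr_mono2) auto
  then show ?thesis
    using p mean_power_nonneg[of p f r] by (simp add: powr_powr)
qed

lemma hardy_space_if_mean_power_le:
  assumes p: "1 < p" and f: "f holomorphic_vec_on polydisk"
    and le: "\<And>r. \<lbrakk>0 < r; r < 1\<rbrakk> \<Longrightarrow> mean_power p f r \<le> B"
  shows "f \<in> hardy_space p" "hardy_norm p f \<le> B powr (1 / p)"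
proof -
  have le': "hardy_mean p f r \<le> B powr (1 / p)" if "r \<in> {0<..<1}" for r
    unfolding hardy_mean_eq using that p le mean_power_nonneg by (intro powr_mono2) auto
  then show "f \<in> hardy_space p"
    unfolding hardy_space_def using f by (auto intro!: bdd_aboveI2[where M = "B powr (1 / p)"])
  show "hardy_norm p f \<le> B powr (1 / p)"
    unfolding hardy_norm_def using le' by (intro cSUP_least) auto
qed

subsection \<open>The extremal function\<close>

text \<open>This is |f_min|^p on the torus of radius \<open>r\<close>, up to a constant that depends
  on neither \<open>r\<close> nor \<open>t\<close>. Setting \<open>r = 1\<close> would give exactly
  the Poisson weight of \<open>a\<close> on the unit torus.\<close>

definition extremal_density :: "complex ^ 'n \<Rightarrow> real \<Rightarrow> real ^ 'n \<Rightarrow> real" where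
  "extremal_density a r t =
     (\<Prod>j\<in>UNIV. (1 - (norm (a $ j))\<^sup>2) / (2 * pi * (norm (1 - of_real r * cis (t $ j) * cnj (a $ j)))\<^sup>2))"

text \<open>Conjugation and multiplication by the unimodular \<open>cis s\<close> preserve the
  modulus. The denominator of the extremal function thereby becomes a distance, as in a Poisson
  kernel.\<close>

lemma norm_one_minus_cis:
  "norm (1 - of_real r * cis s * cnj a) = norm (cis s - of_real r * a)"
proof -
  have "cis s * cnj (1 - of_real r * cis s * cnj a) = cis s - of_real r * (cis s * cis (- s)) * a"
    by (simp add: algebra_simps cis_cnj)
  then have "cis s * cnj (1 - of_real r * cis s * cnj a) = cis s - of_real r * a"
    by (simp add: cis_mult)
  then have "norm (cis s * cnj (1 - of_real r * cis s * cnj a)) = norm (cis s - of_real r * a)"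
    by simp
  then show ?thesis by (simp only: norm_mult complex_mod_cnj norm_cis mult_1)
qed

lemma one_minus_ne:
  assumes "norm a < 1" "norm z \<le> 1"
  shows "1 - z * cnj a \<noteq> (0 :: complex)"
proof
  assume "1 - z * cnj a = 0"
  then have "norm (z * cnj a) = 1" by simp
  moreover have "norm (z * cnj a) \<le> norm a"
    using assms mult_right_mono[of "norm z" 1 "norm a"] by (simp add: norm_mult)
  ultimately show False using assms by simp
qed

text \<open>
  Up to the factor \<open>(1 - |a|\<^sup>2) / (1 - r\<^sup>2 |a|\<^sup>2)\<close>, each factor of the extremal density is the Poisson
  kernel of the point \<open>r\<^sup>2 a\<close>.
\<close>

lemma extremal_density_le_poisson_weight:
  fixes a :: "complex ^ 'n"
  assumes a: "a \<in> polydisk" and r: "0 < r" "r < 1"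
  shows "extremal_density a r t \<le> poisson_weight r (\<chi> j. of_real (r\<^sup>2) * a $ j) t"
  unfolding extremal_density_def poisson_weight_def
proof (intro prod_mono conjI)
  fix j :: 'n
  let ?a = "a $ j" and ?d = "norm (cis (t $ j) - of_real r * a $ j)"
  have a1: "norm ?a < 1" using a by (simp add: polydisk_def)
  have n: "(norm ?a)\<^sup>2 \<le> 1" using a1 by (simp add: power_le_one)
  show "0 \<le> (1 - (norm ?a)\<^sup>2) / (2 * pi * (norm (1 - of_real r * cis (t $ j) * cnj ?a))\<^sup>2)"
    using n by (intro divide_nonneg_nonneg) auto
  have "(norm ?a)\<^sup>2 * r\<^sup>2 \<le> (norm ?a)\<^sup>2 * 1"
    using r by (intro mult_left_mono) (auto simp: power_le_one)
  then have le: "1 - (norm ?a)\<^sup>2 \<le> 1 - r\<^sup>2 * (norm ?a)\<^sup>2" by (simp add: mult.commute)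
  have "of_real r * cis (t $ j) - of_real (r\<^sup>2) * ?a = of_real r * (cis (t $ j) - of_real r * ?a)"
    by (simp add: algebra_simps power2_eq_square)
  then have d: "norm (of_real r * cis (t $ j) - of_real (r\<^sup>2) * ?a) = r * ?d"
    using r by (simp add: norm_mult)
  have "(1 - (norm ?a)\<^sup>2) / (2 * pi * ?d\<^sup>2) \<le> (1 - r\<^sup>2 * (norm ?a)\<^sup>2) / (2 * pi * ?d\<^sup>2)"
    using le by (intro divide_right_mono) auto
  \<comment> \<open>Expanding by \<open>r\<^sup>2\<close> produces the numerator r^2 - |r^2 a|^2 and
    the squared distance from r e^(it) to r^2 a.\<close>
  also have "\<dots> = (r\<^sup>2 * (1 - r\<^sup>2 * (norm ?a)\<^sup>2)) / (r\<^sup>2 * (2 * pi * ?d\<^sup>2))"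
    using r by simp
  also have "\<dots> = poisson_kernel r (of_real (r\<^sup>2) * ?a) (t $ j)"
    unfolding poisson_kernel_def d
    by (simp add: norm_mult norm_power power_mult_distrib algebra_simps power2_eq_square)
  finally show "(1 - (norm ?a)\<^sup>2) / (2 * pi * (norm (1 - of_real r * cis (t $ j) * cnj ?a))\<^sup>2)
      \<le> poisson_kernel r ((\<chi> j. of_real (r\<^sup>2) * a $ j) $ j) (t $ j)"
    unfolding norm_one_minus_cis by simp
qed

text \<open>A bound, uniform in the angles, for the ratio of the Poisson weight of \<open>a\<close>
  to the extremal density.\<close>

definition distortion :: "complex ^ 'n \<Rightarrow> real \<Rightarrow> real" where
  "distortion a r = (\<Prod>j\<in>UNIV. (1 + 2 * (1 - r) / (r - norm (a $ j)))\<^sup>2)"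

lemma tendsto_distortion:
  assumes "a \<in> polydisk"
  shows "(distortion a \<longlongrightarrow> 1) (at_left 1)"
proof -
  have "(distortion a \<longlongrightarrow> (\<Prod>j\<in>UNIV. (1 + 2 * (1 - 1) / (1 - norm (a $ j)))\<^sup>2)) (at_left 1)"
    unfolding distortion_def using assms
    by (intro tendsto_intros) (auto simp: polydisk_def less_imp_neq)
  then show ?thesis by simp
qed

text \<open>In each coordinate the two denominators involve d = |r e^(it) - a| and m = |e^(it) - r
  a|. The difference of the two vectors is (1 - r)(e^(it) + a), so m is at most d + 2 (1 - r); since
  d is at least r - |a|, this error is a small multiple of d.\<close>

lemma poisson_weight_le_extremal_density:
  fixes a :: "complex ^ 'n"
  assumes r: "0 < r" "r < 1" and a: "\<And>j. norm (a $ j) < r"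
  shows "poisson_weight r a t \<le> distortion a r * extremal_density a r t"
  unfolding poisson_weight_def distortion_def extremal_density_def prod.distrib[symmetric]
proof (intro prod_mono conjI less_imp_le[OF poisson_kernel_pos] r a)
  fix j :: 'n
  let ?a = "a $ j"
  define d where "d = norm (of_real r * cis (t $ j) - ?a)"
  define m where "m = norm (cis (t $ j) - of_real r * ?a)"
  have d_ge: "r - norm ?a \<le> d"
    using norm_triangle_ineq2[of "of_real r * cis (t $ j)" ?a] r by (simp add: d_def norm_of_real_cis)
  have d0: "d > 0" using d_ge a[of j] by simp
  have "1 - of_real r * cis (t $ j) * cnj ?a \<noteq> 0"
    using a[of j] r by (intro one_minus_ne) (auto simp: norm_of_real_cis)
  then have m0: "m > 0"
    unfolding m_def norm_one_minus_cis[symmetric] by (simp only: zero_less_norm_iff not_False_eq_True)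
  have "cis (t $ j) - of_real r * ?a
      = (of_real r * cis (t $ j) - ?a) + of_real (1 - r) * (cis (t $ j) + ?a)"
    by (simp add: algebra_simps)
  then have "m \<le> d + norm (of_real (1 - r) * (cis (t $ j) + ?a))"
    unfolding m_def d_def by (metis norm_triangle_ineq)
  also have "norm (of_real (1 - r) * (cis (t $ j) + ?a)) = (1 - r) * norm (cis (t $ j) + ?a)"
    using r by (simp add: norm_mult del: of_real_diff)
  also have "\<dots> \<le> (1 - r) * 2"
    using norm_triangle_ineq[of "cis (t $ j)" ?a] a[of j] r by (intro mult_left_mono) auto
  also have "d + (1 - r) * 2 \<le> d + d * (2 * (1 - r) / (r - norm ?a))"
  proof -
    have "(1 - r) * 2 = (r - norm ?a) * (2 * (1 - r) / (r - norm ?a))"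
      using a[of j] by simp
    also have "\<dots> \<le> d * (2 * (1 - r) / (r - norm ?a))"
      using d_ge a[of j] r by (intro mult_right_mono divide_nonneg_nonneg) auto
    finally show ?thesis by simp
  qed
  also have "\<dots> = (1 + 2 * (1 - r) / (r - norm ?a)) * d" by (simp add: algebra_simps)
  finally have "m \<le> (1 + 2 * (1 - r) / (r - norm ?a)) * d" by simp
  then have "m\<^sup>2 \<le> (1 + 2 * (1 - r) / (r - norm ?a))\<^sup>2 * d\<^sup>2"
    unfolding power_mult_distrib[symmetric] using m0 by (intro power_mono) auto
  then have "1 / d\<^sup>2 \<le> (1 + 2 * (1 - r) / (r - norm ?a))\<^sup>2 * (1 / m\<^sup>2)"
    using m0 d0 by (simp add: pos_divide_le_eq pos_le_divide_eq)
  then have "(1 - (norm ?a)\<^sup>2) / (2 * pi) * (1 / d\<^sup>2)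
      \<le> (1 - (norm ?a)\<^sup>2) / (2 * pi) * ((1 + 2 * (1 - r) / (r - norm ?a))\<^sup>2 * (1 / m\<^sup>2))"
    using a[of j] r by (intro mult_left_mono) (auto simp: power_le_one)
  moreover have "(r\<^sup>2 - (norm ?a)\<^sup>2) / (2 * pi) * (1 / d\<^sup>2) \<le> (1 - (norm ?a)\<^sup>2) / (2 * pi) * (1 / d\<^sup>2)"
    using r by (intro mult_right_mono divide_right_mono) (auto simp: power_le_one)
  ultimately show "poisson_kernel r ?a (t $ j) \<le> (1 + 2 * (1 - r) / (r - norm ?a))\<^sup>2 *
      ((1 - (norm ?a)\<^sup>2) / (2 * pi * (norm (1 - of_real r * cis (t $ j) * cnj ?a))\<^sup>2))"
    unfolding poisson_kernel_def norm_one_minus_cis d_def[symmetric] m_def[symmetric]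
    by (simp add: mult_ac)
qed

section \<open>Holomorphy, zero-freeness and modulus of the extremal function\<close>

lemma f_min_factor_holomorphic:
  assumes a: "a \<in> polydisk"
  shows "(\<lambda>z :: complex ^ 'n. (of_real (1 - (norm (a $ j))\<^sup>2) / (1 - z $ j * cnj (a $ j))) powr of_real (2 / p))
    holomorphic_vec_on polydisk"
proof (rule holomorphic_vec_on_compose[OF holomorphic_vec_on_component])
  fix z :: "complex ^ 'n" assume "z \<in> polydisk"
  then have z: "norm (z $ j) < 1" by (simp add: polydisk_def)
  have a1: "norm (a $ j) < 1" using a by (simp add: polydisk_def)
  define c where "c = 1 - (norm (a $ j))\<^sup>2"
  have c: "c > 0" unfolding c_def using a1 by (simp add: power_less_one_iff)
  let ?b = "1 - z $ j * cnj (a $ j)"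
  \<comment> \<open>Hence the denominator has positive real part, and so has a positive number
    divided by it. The base of the power thus avoids the branch cut.\<close>
  have "norm (z $ j * cnj (a $ j)) < 1"
    using z a1 mult_strict_mono'[of "norm (z $ j)" 1 "norm (a $ j)" 1] by (simp add: norm_mult)
  then have Re: "Re ?b > 0"
    using complex_Re_le_cmod[of "z $ j * cnj (a $ j)"] by simp
  then have "Re (of_real c / ?b) > 0"
    using c by (auto simp: Re_divide intro!: divide_pos_pos mult_pos_pos sum_power2_gt_zero_iff[THEN iffD2])
  then have "of_real c / ?b \<notin> \<real>\<^sub>\<le>\<^sub>0"
    by (meson complex_nonpos_Reals_iff not_le)
  moreover have "?b \<noteq> 0" using Re by (metis less_irrefl zero_complex.sel(1))
  ultimately show "(\<lambda>w. (of_real (1 - (norm (a $ j))\<^sup>2) / (1 - w * cnj (a $ j))) powr of_real (2 / p))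
      field_differentiable at (z $ j)"
    unfolding c_def[symmetric] field_differentiable_def
    by (intro exI) (rule derivative_eq_intros refl | simp)+
qed

lemma f_min_holomorphic: "a \<in> polydisk \<Longrightarrow> f_min p a w holomorphic_vec_on polydisk"
  unfolding f_min_def
  by (intro holomorphic_vec_on_mult holomorphic_vec_on_const holomorphic_vec_on_prod
      f_min_factor_holomorphic) auto

lemma f_min_interpolates:
  assumes a: "a \<in> polydisk"
  shows "f_min p a w a = w"
proof -
  have "of_real (1 - (norm (a $ j))\<^sup>2) / (1 - a $ j * cnj (a $ j)) = (1 :: complex)" for j
  proof -
    have "1 - a $ j * cnj (a $ j) = of_real (1 - (norm (a $ j))\<^sup>2)"
      using complex_norm_square[of "a $ j"] by simp
    moreover have "1 - a $ j * cnj (a $ j) \<noteq> 0"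
      using a by (intro one_minus_ne) (auto simp: polydisk_def less_imp_le)
    ultimately show ?thesis by simp
  qed
  then show ?thesis unfolding f_min_def by simp
qed

lemma f_min_nonzero:
  assumes a: "a \<in> polydisk" and z: "z \<in> polydisk" and w: "w \<noteq> 0"
  shows "f_min p a w z \<noteq> 0"
proof -
  have "1 - z $ j * cnj (a $ j) \<noteq> 0" for j
    using a z by (intro one_minus_ne) (auto simp: polydisk_def less_imp_le)
  moreover have "of_real (1 - (norm (a $ j))\<^sup>2) \<noteq> (0 :: complex)" for j
    using a power_less_one_iff[of "norm (a $ j)" 2] by (simp add: polydisk_def del: of_real_diff)
  ultimately show ?thesis
    using w unfolding f_min_def by (simp del: of_real_diff)
qed

lemma holomorphic_vec_on_divide_f_min:
  assumes f: "f holomorphic_vec_on polydisk" and a: "a \<in> polydisk" and w: "w \<noteq> 0"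
  shows "(\<lambda>z. f z / f_min p a w z) holomorphic_vec_on polydisk"
proof -
  have "(\<lambda>z. inverse (f_min p a w z)) holomorphic_vec_on polydisk"
    using f_min_nonzero[OF a _ w]
    by (intro holomorphic_vec_on_compose[OF f_min_holomorphic[OF a], where h = inverse])
       (auto intro!: field_differentiable_inverse field_differentiable_ident)
  from holomorphic_vec_on_mult[OF f this] show ?thesis
    unfolding divide_inverse .
qed

text \<open>The exponent 2 / p is real, so moduli pass through the power, and raising to
  \<open>p\<close> leaves plain squares.\<close>

lemma norm_f_min_powr:
  fixes a :: "complex ^ 'n"
  assumes p: "1 < p" and a: "a \<in> polydisk"
  shows "norm (f_min p a w (torus r t)) powr p
    = norm w powr p * (\<Prod>j\<in>UNIV. 1 - (norm (a $ j))\<^sup>2) * (2 * pi) ^ CARD('n) * extremal_density a r t"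
proof -
  let ?c = "\<lambda>j. 1 - (norm (a $ j))\<^sup>2" and ?n = "\<lambda>j. norm (1 - of_real r * cis (t $ j) * cnj (a $ j))"
  have c: "?c j \<ge> 0" for j using a by (simp add: polydisk_def power_le_one less_imp_le)
  have "norm (f_min p a w (torus r t)) powr p
      = (norm w * (\<Prod>j\<in>UNIV. (?c j / ?n j) powr (2 / p))) powr p"
    unfolding f_min_def using c
    by (simp add: norm_mult prod_norm[symmetric] norm_powr_real_powr' norm_divide del: of_real_diff of_real_divide)
  also have "\<dots> = norm w powr p * (\<Prod>j\<in>UNIV. ((?c j / ?n j) powr (2 / p)) powr p)"
    by (simp add: powr_mult prod_nonneg prod_powr_distrib)
  also have "(\<Prod>j\<in>UNIV. ((?c j / ?n j) powr (2 / p)) powr p) = (\<Prod>j\<in>UNIV. (?c j / ?n j)\<^sup>2)"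
    using p c by (intro prod.cong) (auto simp: powr_powr powr_numeral)
  \<comment> \<open>One copy of \<open>?c j\<close> and a factor 2 pi are split off from each
    square; what remains is a factor of the extremal density.\<close>
  also have "\<dots> = (\<Prod>j\<in>UNIV. ?c j * ((2 * pi) * (?c j / (2 * pi * (?n j)\<^sup>2))))"
    by (intro prod.cong) (auto simp: power2_eq_square)
  also have "\<dots> = (\<Prod>j\<in>UNIV. ?c j) * ((2 * pi) ^ CARD('n) * extremal_density a r t)"
    unfolding extremal_density_def prod.distrib by simp
  finally show ?thesis by (simp add: mult.assoc)
qed

subsection \<open>Minimality and uniqueness\<close>

text \<open>At every radius the density is dominated by a Poisson weight of total mass 1, so all
  means obey the same bound. Only this upper bound is computed directly; the reverse inequality is
  an instance of the lower bound for all competitors.\<close>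

lemma f_min_in_hardy_space:
  fixes a :: "complex ^ 'n"
  assumes p: "1 < p" and a: "a \<in> polydisk"
  shows "f_min p a w \<in> hardy_space p"
    and "hardy_norm p (f_min p a w) \<le> (norm w powr p * (\<Prod>j\<in>UNIV. 1 - (norm (a $ j))\<^sup>2)) powr (1 / p)"
proof -
  define M where "M = norm w powr p * (\<Prod>j\<in>UNIV. 1 - (norm (a $ j))\<^sup>2)"
  have "0 \<le> (\<Prod>j\<in>UNIV. 1 - (norm (a $ j))\<^sup>2)"
    using a by (intro prod_nonneg) (simp add: polydisk_def power_le_one less_imp_le)
  then have M: "0 \<le> M" unfolding M_def by simp
  have le: "mean_power p (f_min p a w) r \<le> M" if r: "0 < r" "r < 1" for r
  proof -
    let ?b = "\<chi> j. of_real (r\<^sup>2) * a $ j"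
    let ?P = "(2 * pi) ^ CARD('n)"
    have b: "norm (?b $ j) < r" for j
    proof -
      have "norm (?b $ j) = r * (r * norm (a $ j))"
        using r by (simp add: norm_mult norm_power power2_eq_square)
      also have "\<dots> < r * 1"
      proof (rule mult_strict_left_mono[OF _ r(1)])
        have "r * norm (a $ j) \<le> 1 * norm (a $ j)"
          using r by (intro mult_right_mono) auto
        then show "r * norm (a $ j) < 1"
          using a by (simp add: polydisk_def) (meson le_less_trans)
      qed
      finally show ?thesis by simp
    qed
    have cf: "continuous_on UNIV (\<lambda>t. f_min p a w (torus r t))"
      by (rule continuous_on_torus[OF holomorphic_vec_on_imp_continuous_on[OF f_min_holomorphic[OF a]] r])
    have "angle_integral (\<lambda>t. norm (f_min p a w (torus r t)) powr p)
        \<le> angle_integral (\<lambda>t. M * ?P * poisson_weight r ?b t)"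
    proof (intro angle_integral_mono)
      show "continuous_on UNIV (\<lambda>t. norm (f_min p a w (torus r t)) powr p)"
        using p by (intro continuous_on_powr' continuous_intros cf) auto
      show "continuous_on UNIV (\<lambda>t. M * ?P * poisson_weight r ?b t)"
        by (rule continuous_on_mult[OF continuous_on_const continuous_on_poisson_weight[OF r(1) b]])
      show "norm (f_min p a w (torus r t)) powr p \<le> M * ?P * poisson_weight r ?b t" for t
        unfolding norm_f_min_powr[OF p a] M_def[symmetric]
        using M by (intro mult_left_mono extremal_density_le_poisson_weight a r) auto
    qed
    also have "\<dots> = M * ?P"
      using angle_integral_poisson_weight[OF r b] by simp
    finally show ?thesis
      unfolding mean_power_def by (simp add: pos_divide_le_eq)
  qed
  note * = hardy_space_if_mean_power_le[OF p f_min_holomorphic[OF a] le]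
  show "f_min p a w \<in> hardy_space p" by (rule *(1))
  show "hardy_norm p (f_min p a w) \<le> (norm w powr p * (\<Prod>j\<in>UNIV. 1 - (norm (a $ j))\<^sup>2)) powr (1 / p)"
    using *(2) unfolding M_def .
qed

text \<open>
  \<open>f / f_min\<close> has Poisson average 1 at \<open>a\<close>, so averaging the gap, that is the defect in Jensen's
  inequality at 1, compares the \<open>p\<close>-th power mean of the quotient with 1.
\<close>

lemma poisson_average_gap_le:
  fixes a :: "complex ^ 'n" and f :: "complex ^ 'n \<Rightarrow> complex"
  assumes p: "1 < p" and a: "a \<in> polydisk" and f: "f \<in> hardy_space p" "f a = w" and w: "w \<noteq> 0"
    and r: "0 < r" "r < 1" and ar: "\<And>j. norm (a $ j) < r"
  shows "(norm w powr p * (\<Prod>j\<in>UNIV. 1 - (norm (a $ j))\<^sup>2)) *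
      (1 + angle_integral (\<lambda>t. poisson_weight r a t * powr_gap p (f (torus r t) / f_min p a w (torus r t))))
    \<le> distortion a r * hardy_norm p f powr p"
proof -
  define M where "M = norm w powr p * (\<Prod>j\<in>UNIV. 1 - (norm (a $ j))\<^sup>2)"
  define u where "u z = f z / f_min p a w z" for z
  let ?P = "(2 * pi) ^ CARD('n)" and ?W = "poisson_weight r a"
  have "0 < (\<Prod>j\<in>UNIV. 1 - (norm (a $ j))\<^sup>2)"
    using a power_less_one_iff[of "norm (a $ j)" 2 for j] by (intro prod_pos) (simp add: polydisk_def)
  then have M: "0 < M" unfolding M_def using w by simp
  have hf: "f holomorphic_vec_on polydisk" using f unfolding hardy_space_def by simp
  have hu: "u holomorphic_vec_on polydisk"
    unfolding u_def by (rule holomorphic_vec_on_divide_f_min[OF hf a w])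
  have ua: "u a = 1" unfolding u_def using f w f_min_interpolates[OF a] by simp
  have cu: "continuous_on UNIV (\<lambda>t. u (torus r t))"
    by (rule continuous_on_torus[OF holomorphic_vec_on_imp_continuous_on[OF hu] r])
  have cf: "continuous_on UNIV (\<lambda>t. f (torus r t))"
    by (rule continuous_on_torus[OF holomorphic_vec_on_imp_continuous_on[OF hf] r])
  have cW: "continuous_on UNIV ?W" by (rule continuous_on_poisson_weight[OF r(1) ar])
  have cup: "continuous_on UNIV (\<lambda>t. norm (u (torus r t)) powr p)"
    using p by (intro continuous_on_powr' continuous_intros cu) auto
  have cfp: "continuous_on UNIV (\<lambda>t. norm (f (torus r t)) powr p)"
    using p by (intro continuous_on_powr' continuous_intros cf) auto
  have ReI: "angle_integral (\<lambda>t. ?W t * Re (u (torus r t))) = 1"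
  proof -
    have int: "set_integrable lborel angles (\<lambda>t. ?W t *\<^sub>R u (torus r t))"
      by (intro set_integrable_angles continuous_intros cW cu)
    have "angle_integral (\<lambda>t. ?W t * Re (u (torus r t)))
        = Re (angle_integral (\<lambda>t. ?W t *\<^sub>R u (torus r t)))"
      using integral_Re[OF int[unfolded set_integrable_def]]
      unfolding set_lebesgue_integral_def by (simp add: mult.assoc)
    then show ?thesis
      using poisson_weight_integral[OF hu r ar] ua by simp
  qed
  \<comment> \<open>The gap of \<open>u\<close> is |u|^p + (p - 1) - p Re u. The weight has mass 1
    and Re u has average 1, so the last two terms contribute (p - 1) - p = -1.\<close>
  have "angle_integral (\<lambda>t. ?W t * powr_gap p (u (torus r t)))
      = angle_integral (\<lambda>t. ?W t * norm (u (torus r t)) powr p + (p - 1) * ?W t - p * (?W t * Re (u (torus r t))))"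
    by (simp add: powr_gap_def algebra_simps)
  also have "\<dots> = angle_integral (\<lambda>t. ?W t * norm (u (torus r t)) powr p)
      + angle_integral (\<lambda>t. (p - 1) * ?W t) - angle_integral (\<lambda>t. p * (?W t * Re (u (torus r t))))"
  proof -
    have i: "set_integrable lborel angles (\<lambda>t. ?W t * norm (u (torus r t)) powr p)"
      "set_integrable lborel angles (\<lambda>t. (p - 1) * ?W t)"
      "set_integrable lborel angles (\<lambda>t. p * (?W t * Re (u (torus r t))))"
      by (intro set_integrable_angles continuous_on_mult continuous_on_const continuous_on_Re cW cup cu)+
    show ?thesis
      by (simp only: set_integral_diff(2)[OF set_integral_add(1)[OF i(1,2)] i(3)]
          set_integral_add(2)[OF i(1,2)])
  qed
  also have "\<dots> = angle_integral (\<lambda>t. ?W t * norm (u (torus r t)) powr p) - 1"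
    using ReI angle_integral_poisson_weight[OF r ar] by simp
  finally have gap: "1 + angle_integral (\<lambda>t. ?W t * powr_gap p (u (torus r t)))
      = angle_integral (\<lambda>t. ?W t * norm (u (torus r t)) powr p)" by simp
  have "M * ?P * angle_integral (\<lambda>t. ?W t * norm (u (torus r t)) powr p)
      = angle_integral (\<lambda>t. M * ?P * (?W t * norm (u (torus r t)) powr p))" by simp
  also have "\<dots> \<le> angle_integral (\<lambda>t. distortion a r * norm (f (torus r t)) powr p)"
  proof (rule angle_integral_mono)
    show "continuous_on UNIV (\<lambda>t. M * ?P * (?W t * norm (u (torus r t)) powr p))"
      by (intro continuous_on_mult continuous_on_const cW cup)
    show "continuous_on UNIV (\<lambda>t. distortion a r * norm (f (torus r t)) powr p)"
      by (intro continuous_on_mult continuous_on_const cfp)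
  next
    fix t
    have "f (torus r t) = f_min p a w (torus r t) * u (torus r t)"
      unfolding u_def using f_min_nonzero[OF a torus_in_polydisk[OF r] w] by simp
    then have eq: "norm (f (torus r t)) powr p
        = M * ?P * extremal_density a r t * norm (u (torus r t)) powr p"
      using norm_f_min_powr[OF p a, of w r t] by (simp add: norm_mult powr_mult M_def)
    \<comment> \<open>Up to the distortion, \<open>M * ?P * ?W t\<close> is at most |f_min|^p, and
      |f_min|^p |u|^p is |f|^p.\<close>
    have "M * ?P * (?W t * norm (u (torus r t)) powr p)
        \<le> M * ?P * ((distortion a r * extremal_density a r t) * norm (u (torus r t)) powr p)"
      using M by (intro mult_left_mono mult_right_mono poisson_weight_le_extremal_density r ar) auto
    then show "M * ?P * (?W t * norm (u (torus r t)) powr p) \<le> distortion a r * norm (f (torus r t)) powr p"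
      unfolding eq by (simp add: mult_ac)
  qed
  also have "\<dots> = ?P * (distortion a r * mean_power p f r)"
    by (simp add: mean_power_def)
  also have "\<dots> \<le> ?P * (distortion a r * hardy_norm p f powr p)"
    by (intro mult_left_mono mean_power_le p f r) (auto simp: distortion_def intro!: prod_nonneg)
  finally have "?P * (M * angle_integral (\<lambda>t. ?W t * norm (u (torus r t)) powr p))
      \<le> ?P * (distortion a r * hardy_norm p f powr p)" by (simp add: mult_ac)
  then have "M * (1 + angle_integral (\<lambda>t. ?W t * powr_gap p (u (torus r t))))
      \<le> distortion a r * hardy_norm p f powr p"
    unfolding gap by (rule mult_left_le_imp_le) simp
  then show ?thesis
    unfolding M_def u_def .
qed

section \<open>Lower bound for competitors and uniqueness of the minimizer\<close>

lemma eventually_radius: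
  fixes a :: "complex ^ 'n"
  assumes a: "a \<in> polydisk" and P: "\<And>r. \<lbrakk>0 < r; r < 1; \<And>j. norm (a $ j) < r\<rbrakk> \<Longrightarrow> P r"
  shows "eventually P (at_left 1)"
proof -
  obtain r0 where r0: "0 < r0" "r0 < 1" "\<And>j. norm (a $ j) < r0"
    using exists_radius[OF a a] by blast
  show ?thesis
  proof (rule eventually_at_leftI[OF _ r0(2)])
    fix r assume "r \<in> {r0<..<1}"
    then have r: "r0 < r" "r < 1" by auto
    show "P r"
      by (rule P[OF less_trans[OF r0(1) r(1)] r(2) less_trans[OF r0(3) r(1)]])
  qed
qed

text \<open>The average of the nonnegative gap is dropped from the preceding estimate, and the
  distortion tends to 1 with \<open>r\<close>.\<close>

lemma hardy_norm_lower_bound: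
  fixes a :: "complex ^ 'n"
  assumes p: "1 < p" and a: "a \<in> polydisk" and f: "f \<in> hardy_space p" "f a = w"
  shows "norm w powr p * (\<Prod>j\<in>UNIV. 1 - (norm (a $ j))\<^sup>2) \<le> hardy_norm p f powr p"
proof (cases "w = 0")
  case False
  let ?M = "norm w powr p * (\<Prod>j\<in>UNIV. 1 - (norm (a $ j))\<^sup>2)"
  have M: "?M \<ge> 0"
    using a by (intro mult_nonneg_nonneg prod_nonneg) (auto simp: polydisk_def power_le_one less_imp_le)
  have "eventually (\<lambda>r. ?M \<le> distortion a r * hardy_norm p f powr p) (at_left 1)"
  proof (rule eventually_radius[OF a])
    fix r assume r: "0 < r" "r < 1" and ar: "\<And>j. norm (a $ j) < r"
    let ?I = "angle_integral (\<lambda>t. poisson_weight r a t * powr_gap p (f (torus r t) / f_min p a w (torus r t)))"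
    have "0 \<le> ?I"
      unfolding set_lebesgue_integral_def
      using powr_gap_nonneg[OF p] poisson_weight_pos[OF r(1), of a] ar
      by (intro Bochner_Integration.integral_nonneg) (simp add: less_imp_le)
    then have "?M * 1 \<le> ?M * (1 + ?I)" using M by (intro mult_left_mono) auto
    also have "\<dots> \<le> distortion a r * hardy_norm p f powr p"
      by (rule poisson_average_gap_le[OF p a f False r ar])
    finally show "?M \<le> distortion a r * hardy_norm p f powr p" by simp
  qed
  from tendsto_lowerbound[OF tendsto_mult_right[OF tendsto_distortion[OF a]] this]
  show ?thesis by simp
qed simp

text \<open>The constant \<open>C\<close> may depend on \<open>e\<close>: for fixed \<open>e\<close>
  the limit in \<open>r\<close> is taken first. Both pointwise bounds by \<open>powr_gap\<close> and
  by the \<open>p\<close>-th power have this form.\<close>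

lemma tendsto_zero_if_le:
  fixes h k :: "real \<Rightarrow> real"
  assumes k: "(k \<longlongrightarrow> 0) F" and nonneg: "eventually (\<lambda>r. 0 \<le> h r) F"
    and le: "\<And>e. 0 < e \<Longrightarrow> \<exists>C. eventually (\<lambda>r. h r \<le> e + C * k r) F"
  shows "(h \<longlongrightarrow> 0) F"
proof (rule tendstoI)
  fix e :: real assume e: "0 < e"
  then obtain C where C: "eventually (\<lambda>r. h r \<le> e / 2 + C * k r) F"
    using le[of "e / 2"] by auto
  have "((\<lambda>r. C * k r) \<longlongrightarrow> 0) F"
    using tendsto_mult_right_zero[OF k] .
  then have "eventually (\<lambda>r. dist (C * k r) 0 < e / 2) F"
    by (rule tendstoD) (use e in simp)
  with C nonneg show "eventually (\<lambda>r. dist (h r) 0 < e) F"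
    by eventually_elim (simp add: dist_real_def)
qed

text \<open>Equality of norms leaves at most \<open>distortion a r - 1\<close> for the average gap
  of the quotient \<open>u\<close>. The gap controls |u - 1| up to \<open>e\<close>, so the average
  of |u - 1| vanishes in the limit.\<close>

lemma hardy_norm_equality:
  fixes a :: "complex ^ 'n"
  assumes p: "1 < p" and a: "a \<in> polydisk" and f: "f \<in> hardy_space p" "f a = w" and w: "w \<noteq> 0"
    and le: "hardy_norm p f powr p \<le> norm w powr p * (\<Prod>j\<in>UNIV. 1 - (norm (a $ j))\<^sup>2)"
    and z: "z \<in> polydisk"
  shows "f z = f_min p a w z"
proof -
  define M where "M = norm w powr p * (\<Prod>j\<in>UNIV. 1 - (norm (a $ j))\<^sup>2)"
  define u where "u z = f z / f_min p a w z" for z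
  have "0 < (\<Prod>j\<in>UNIV. 1 - (norm (a $ j))\<^sup>2)"
    using a power_less_one_iff[of "norm (a $ j)" 2 for j] by (intro prod_pos) (simp add: polydisk_def)
  then have M: "0 < M" unfolding M_def using w by simp
  have hf: "f holomorphic_vec_on polydisk" using f unfolding hardy_space_def by simp
  have hu: "u holomorphic_vec_on polydisk"
    unfolding u_def by (rule holomorphic_vec_on_divide_f_min[OF hf a w])
  have hu1: "(\<lambda>z. u z - 1) holomorphic_vec_on polydisk"
    by (rule holomorphic_vec_on_compose[OF hu, where h = "\<lambda>x. x - 1"])
       (intro field_differentiable_diff field_differentiable_ident field_differentiable_const)
  let ?h = "\<lambda>r. angle_integral (\<lambda>t. poisson_weight r a t * norm (u (torus r t) - 1))"
  have "(?h \<longlongrightarrow> 0) (at_left 1)"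
  proof (rule tendsto_zero_if_le)
    show "((\<lambda>r. distortion a r - 1) \<longlongrightarrow> 0) (at_left 1)"
      using tendsto_diff[OF tendsto_distortion[OF a] tendsto_const[of 1]] by simp
    show "eventually (\<lambda>r. 0 \<le> ?h r) (at_left 1)"
    proof (rule eventually_radius[OF a])
      fix r assume r: "0 < r" "r < 1" and ar: "\<And>j. norm (a $ j) < r"
      show "0 \<le> ?h r"
        unfolding set_lebesgue_integral_def
        using poisson_weight_pos[of r a, OF r(1) ar]
        by (intro Bochner_Integration.integral_nonneg) (simp add: less_imp_le)
    qed
    fix e :: real assume e: "0 < e"
    obtain C where C: "0 \<le> C" "\<And>x. norm (x - 1) \<le> e + C * powr_gap p x"
      using norm_diff_le_powr_gap[OF p e] by blast
    have "eventually (\<lambda>r. ?h r \<le> e + C * (distortion a r - 1)) (at_left 1)"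
    proof (rule eventually_radius[OF a])
      fix r assume r: "0 < r" "r < 1" and ar: "\<And>j. norm (a $ j) < r"
      let ?W = "poisson_weight r a" and ?g = "\<lambda>t. powr_gap p (u (torus r t))"
      have cu: "continuous_on UNIV (\<lambda>t. u (torus r t))"
        by (rule continuous_on_torus[OF holomorphic_vec_on_imp_continuous_on[OF hu] r])
      have cW: "continuous_on UNIV ?W" by (rule continuous_on_poisson_weight[OF r(1) ar])
      have cg: "continuous_on UNIV ?g"
        unfolding powr_gap_def using p
        by (intro continuous_on_diff continuous_on_mult continuous_on_const continuous_on_Re
            continuous_on_powr' continuous_on_norm cu) auto
      have "M * (1 + angle_integral (\<lambda>t. ?W t * ?g t)) \<le> distortion a r * hardy_norm p f powr p"
        unfolding M_def u_def by (rule poisson_average_gap_le[OF p a f w r ar])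
      also have "\<dots> \<le> distortion a r * M"
        using le unfolding M_def
        by (intro mult_left_mono) (auto simp: distortion_def intro!: prod_nonneg)
      finally have "M * (1 + angle_integral (\<lambda>t. ?W t * ?g t)) \<le> M * distortion a r"
        by (simp add: mult.commute)
      from mult_left_le_imp_le[OF this M]
      have gap: "angle_integral (\<lambda>t. ?W t * ?g t) \<le> distortion a r - 1"
        by simp
      have i: "set_integrable lborel angles (\<lambda>t. e * ?W t)"
        "set_integrable lborel angles (\<lambda>t. C * (?W t * ?g t))"
        by (intro set_integrable_angles continuous_on_mult continuous_on_const cW cg)+
      have "?h r \<le> angle_integral (\<lambda>t. e * ?W t + C * (?W t * ?g t))"
      proof (rule angle_integral_mono)
        show "continuous_on UNIV (\<lambda>t. ?W t * norm (u (torus r t) - 1))"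
          by (intro continuous_on_mult continuous_on_norm continuous_on_diff continuous_on_const cW cu)
        show "continuous_on UNIV (\<lambda>t. e * ?W t + C * (?W t * ?g t))"
          by (intro continuous_on_add continuous_on_mult continuous_on_const cW cg)
        show "?W t * norm (u (torus r t) - 1) \<le> e * ?W t + C * (?W t * ?g t)" for t
          using mult_left_mono[OF C(2), of "?W t" "u (torus r t)"] poisson_weight_pos[of r a t, OF r(1) ar]
          by (simp add: algebra_simps)
      qed
      also have "\<dots> = e + C * angle_integral (\<lambda>t. ?W t * ?g t)"
        unfolding set_integral_add(2)[OF i] using angle_integral_poisson_weight[OF r ar] by simp
      also have "\<dots> \<le> e + C * (distortion a r - 1)"
        using gap C(1) by (intro add_left_mono mult_left_mono)
      finally show "?h r \<le> e + C * (distortion a r - 1)" .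
    qed
    then show "\<exists>C. eventually (\<lambda>r. ?h r \<le> e + C * (distortion a r - 1)) (at_left 1)" ..
  qed
  from holomorphic_vec_on_eq_zero[OF hu1 a z this]
  have "u z = 1" by simp
  then show ?thesis
    using f_min_nonzero[OF a z w] by (simp add: u_def)
qed

text \<open>The case \<open>w0 = 0\<close> of uniqueness. The centre 0 is used because its Poisson
  weight is constant, so that the weighted average of |f|^p is \<open>mean_power p f r\<close>
  itself.\<close>

lemma hardy_norm_eq_zero:
  fixes f :: "complex ^ 'n \<Rightarrow> complex"
  assumes p: "1 < p" and f: "f \<in> hardy_space p" "hardy_norm p f \<le> 0" and z: "z \<in> polydisk"
  shows "f z = 0"
proof -
  have hf: "f holomorphic_vec_on polydisk" using f unfolding hardy_space_def by simp
  have 0: "0 \<in> (polydisk :: (complex ^ 'n) set)" by (simp add: polydisk_def)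
  let ?h = "\<lambda>r :: real. angle_integral (\<lambda>t :: real ^ 'n. poisson_weight r 0 t * norm (f (torus r t)))"
  have W: "poisson_weight r 0 t = 1 / (2 * pi) ^ CARD('n)" if "0 < r" for r :: real and t :: "real ^ 'n"
  proof -
    have "poisson_kernel r 0 s = 1 / (2 * pi)" for s
      using that by (simp add: poisson_kernel_def norm_of_real_cis)
    then show ?thesis by (simp add: poisson_weight_def power_one_over)
  qed
  have "(?h \<longlongrightarrow> 0) (at_left 1)"
  \<comment> \<open>The comparison function is 0 because the \<open>p\<close>-th power mean vanishes
    at every radius, not only in the limit.\<close>
  proof (rule tendsto_zero_if_le[where k = "\<lambda>_. 0"])
    show "eventually (\<lambda>r. 0 \<le> ?h r) (at_left 1)"
    proof (rule eventually_radius[OF 0])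
      fix r :: real assume r: "0 < r"
      show "0 \<le> ?h r"
        unfolding set_lebesgue_integral_def W[OF r]
        by (intro Bochner_Integration.integral_nonneg) simp
    qed
    fix e :: real assume e: "0 < e"
    have "eventually (\<lambda>r. ?h r \<le> e) (at_left 1)"
    proof (rule eventually_radius[OF 0])
      fix r :: real assume r: "0 < r" "r < 1"
      define C where "C = e powr (1 - p)"
      let ?W = "poisson_weight r (0 :: complex ^ 'n)"
      have r0: "norm ((0 :: complex ^ 'n) $ j) < r" for j using r by simp
      have cf: "continuous_on UNIV (\<lambda>t. f (torus r t))"
        by (rule continuous_on_torus[OF holomorphic_vec_on_imp_continuous_on[OF hf] r])
      have cW: "continuous_on UNIV ?W" by (rule continuous_on_poisson_weight[OF r(1) r0])
      have cfp: "continuous_on UNIV (\<lambda>t. norm (f (torus r t)) powr p)"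
        using p by (intro continuous_on_powr' continuous_on_norm continuous_on_const cf) auto
      have i: "set_integrable lborel angles (\<lambda>t. e * ?W t)"
        "set_integrable lborel angles (\<lambda>t. C * (?W t * norm (f (torus r t)) powr p))"
        by (intro set_integrable_angles continuous_on_mult continuous_on_const cW cfp)+
      have "?h r \<le> angle_integral (\<lambda>t. e * ?W t + C * (?W t * norm (f (torus r t)) powr p))"
      proof (rule angle_integral_mono)
        show "continuous_on UNIV (\<lambda>t. ?W t * norm (f (torus r t)))"
          by (intro continuous_on_mult continuous_on_norm cW cf)
        show "continuous_on UNIV (\<lambda>t. e * ?W t + C * (?W t * norm (f (torus r t)) powr p))"
          by (intro continuous_on_add continuous_on_mult continuous_on_const cW cfp)
        show "?W t * norm (f (torus r t)) \<le> e * ?W t + C * (?W t * norm (f (torus r t)) powr p)" for t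
          using mult_left_mono[OF norm_le_powr[OF p e], of "?W t" "f (torus r t)"]
            poisson_weight_pos[of r 0 t, OF r(1) r0]
          by (simp add: algebra_simps C_def)
      qed
      also have "\<dots> = e + C * angle_integral (\<lambda>t. ?W t * norm (f (torus r t)) powr p)"
        unfolding set_integral_add(2)[OF i] using angle_integral_poisson_weight[OF r r0] by simp
      also have "angle_integral (\<lambda>t. ?W t * norm (f (torus r t)) powr p) = mean_power p f r"
        unfolding W[OF r(1)] mean_power_def by simp
      also have "mean_power p f r = 0"
        using mean_power_le[OF p f(1) r] mean_power_nonneg[of p f r] f(2) hardy_norm_nonneg[OF f(1)] by simp
      finally show "?h r \<le> e" by simp
    qed
    then show "\<exists>C. eventually (\<lambda>r. ?h r \<le> e + C * 0) (at_left 1)" by simp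
  qed simp
  from holomorphic_vec_on_eq_zero[OF hf 0 z this] show ?thesis .
qed

theorem theorem4p3:
  fixes p :: real and z0 :: "complex ^ 'n" and w0 :: complex
  assumes "1 < p" and "z0 \<in> polydisk"
  shows "is_arg_min (hardy_norm p) (\<lambda>f. f \<in> hardy_space p \<and> f z0 = w0) (f_min p z0 w0)
    \<and> (\<forall>f. is_arg_min (hardy_norm p) (\<lambda>f. f \<in> hardy_space p \<and> f z0 = w0) f
          \<longrightarrow> (\<forall>z\<in>polydisk. f z = f_min p z0 w0 z))
    \<and> hardy_norm p (f_min p z0 w0)
        = norm w0 * (\<Prod>j\<in>UNIV. (1 - (norm (z0 $ j))\<^sup>2) powr (1 / p))"
proof -
  note p = assms(1) and z0 = assms(2)
  define c where "c j = 1 - (norm (z0 $ j))\<^sup>2" for j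
  define M where "M = norm w0 powr p * (\<Prod>j\<in>UNIV. c j)"
  have c: "0 \<le> c j" for j
    using z0 by (simp add: c_def polydisk_def power_le_one less_imp_le)
  have M0: "0 \<le> M" unfolding M_def using c by (simp add: prod_nonneg)
  have M_root: "M powr (1 / p) = norm w0 * (\<Prod>j\<in>UNIV. c j powr (1 / p))"
    unfolding M_def using p c by (simp add: powr_mult prod_nonneg powr_powr prod_powr_distrib)
  have lower: "M powr (1 / p) \<le> hardy_norm p f" if f: "f \<in> hardy_space p" "f z0 = w0" for f
  proof -
    have "M powr (1 / p) \<le> (hardy_norm p f powr p) powr (1 / p)"
      using hardy_norm_lower_bound[OF p z0 f] M0 p unfolding M_def c_def by (intro powr_mono2) auto
    then show ?thesis using p hardy_norm_nonneg[OF f(1)] by (simp add: powr_powr)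
  qed
  have in_space: "f_min p z0 w0 \<in> hardy_space p" "f_min p z0 w0 z0 = w0"
    by (rule f_min_in_hardy_space[OF p z0] f_min_interpolates[OF z0])+
  \<comment> \<open>The bound from above is the estimate of the means; the bound from below holds
    because the extremal function is itself a competitor.\<close>
  have norm: "hardy_norm p (f_min p z0 w0) = M powr (1 / p)"
    using f_min_in_hardy_space(2)[OF p z0, of w0] lower[OF in_space]
    unfolding M_def c_def by (rule antisym)
  have unique: "f z = f_min p z0 w0 z"
    if arg_min: "is_arg_min (hardy_norm p) (\<lambda>f. f \<in> hardy_space p \<and> f z0 = w0) f"
      and z: "z \<in> polydisk" for f z
  proof -
    have f: "f \<in> hardy_space p" "f z0 = w0" using arg_min by (simp_all add: is_arg_min_def)
    have le: "hardy_norm p f \<le> M powr (1 / p)"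
    proof -
      have "\<forall>g. g \<in> hardy_space p \<and> g z0 = w0 \<longrightarrow> hardy_norm p f \<le> hardy_norm p g"
        using arg_min by (simp add: is_arg_min_linorder)
      then have "hardy_norm p f \<le> hardy_norm p (f_min p z0 w0)"
        using in_space by blast
      with norm show ?thesis by simp
    qed
    show ?thesis
    proof (cases "w0 = 0")
      \<comment> \<open>Here \<open>M = 0\<close>, so a minimizer has norm 0, and
        \<open>f_min\<close> is the zero function.\<close>
      case True
      then have "f z = 0"
        using hardy_norm_eq_zero[OF p f(1) _ z] le by (simp add: M_def)
      with True show ?thesis by (simp add: f_min_def)
    next
      case False
      have "hardy_norm p f powr p \<le> (M powr (1 / p)) powr p"
        using le p hardy_norm_nonneg[OF f(1)] by (intro powr_mono2) auto
      then have "hardy_norm p f powr p \<le> M" using p M0 by (simp add: powr_powr)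
      then show ?thesis
        unfolding M_def c_def by (rule hardy_norm_equality[OF p z0 f False _ z])
    qed
  qed
  have "is_arg_min (hardy_norm p) (\<lambda>f. f \<in> hardy_space p \<and> f z0 = w0) (f_min p z0 w0)"
    using in_space lower norm by (simp add: is_arg_min_linorder)
  moreover have "hardy_norm p (f_min p z0 w0)
      = norm w0 * (\<Prod>j\<in>UNIV. (1 - (norm (z0 $ j))\<^sup>2) powr (1 / p))"
    using norm M_root unfolding c_def by simp
  ultimately show ?thesis
    using unique by (intro conjI allI impI ballI)
qed

end
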